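(* The geometric realization functor $P\mapsto|P|$, $f\mapsto|f|$, from the category of countable posets and monotone maps to the category of metrizable uniform spaces and uniformly continuous maps preserves pullbacks, as well as those pushouts that remain pushouts upon barycentric subdivision.
   Context: Geometric realization: for a poset $P$, let $[0,1]^P$ be the set of all functions $P\to[0,1]$ with the metric $d(f,g)=\sup_{s\in P}|f(s)-g(s)|$. Each $p\in P$ is identified with the characteristic function of $\{q\in P: q\le p\}$. Then $|P|\subset[0,1]^P$ is the union of the convex hulls of all nonempty finite chains of $P$, with the induced uniformity. For a monotone map $f\colon P\to Q$ of posets, $|f|\colon|P|\to|Q|$ is the unique map that extends $f$ on vertices (points $p\in P$) and is affine on the convex hull of every finite chain of $P$; it is uniformly continuous. The barycentric subdivision $P^\flat$ of a poset $P$ is the poset of all nonempty finite chains of $P$ ordered by inclusion; a monotone map $f\colon P\to Q$ induces the monotone map $f^\flat\colon P^\flat\to Q^\flat$, $C\mapsto f(C)$. A pushout square of posets remains a pushout upon barycentric subdivision if the square obtained by applying $(-)^\flat$ is again a pushout square in the category of posets and monotone maps. *)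

theory Defs
  imports "HOL-Analysis.Analysis" "HOL-Library.Function_Algebras"
begin

section \<open>Real-valued functions as a real vector space\<close>

instantiation "fun" :: (type, real_vector) real_vector
begin

definition scaleR_fun :: "real \<Rightarrow> ('a \<Rightarrow> 'b) \<Rightarrow> 'a \<Rightarrow> 'b"
  where "scaleR_fun c f = (\<lambda>x. c *\<^sub>R f x)"

instance
  by standard (auto simp: scaleR_fun_def fun_eq_iff algebra_simps)

end

definition affine_on :: "'v::real_vector set \<Rightarrow> ('v \<Rightarrow> 'w::real_vector) \<Rightarrow> bool"
  where "affine_on S F \<longleftrightarrow> (\<forall>x\<in>S. \<forall>y\<in>S. \<forall>t\<in>{0..1::real}.
     F ((1 - t) *\<^sub>R x + t *\<^sub>R y) = (1 - t) *\<^sub>R F x + t *\<^sub>R F y)"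


section \<open>Posets and monotone maps\<close>

text \<open>
  A poset is a reflexive relation \<open>P\<close>, with \<open>(x, y) \<in> P\<close> meaning \<open>x \<le> y\<close>; its underlying set is
  \<open>Field P\<close>. Morphisms of the categories below are functions that are \<^const>\<open>undefined\<close> outside
  the underlying set of their source, so that equality of morphisms is equality of functions and
  composition is \<^const>\<open>compose\<close>.
\<close>

definition posets :: "'a rel set"
  where "posets = {P. Partial_order P}"

definition countable_posets :: "'a rel set"
  where "countable_posets = {P \<in> posets. countable (Field P)}"

definition monotone_maps :: "'a rel \<Rightarrow> 'b rel \<Rightarrow> ('a \<Rightarrow> 'b) set"
  where "monotone_maps P Q =
     {f \<in> Field P \<rightarrow>\<^sub>E Field Q. monotone_on (Field P) (\<lambda>x y. (x, y) \<in> P) (\<lambda>x y. (x, y) \<in> Q) f}"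

text \<open>
  The universal properties are tested against the posets in a given class \<open>\<Z>\<close>, because HOL cannot
  quantify over the types that carry them. The square is
  \<open>p : P \<rightarrow> A\<close>, \<open>q : P \<rightarrow> B\<close>, \<open>f : A \<rightarrow> C\<close>, \<open>g : B \<rightarrow> C\<close> for pullbacks and
  \<open>f : A \<rightarrow> B\<close>, \<open>g : A \<rightarrow> C\<close>, \<open>i : B \<rightarrow> D\<close>, \<open>j : C \<rightarrow> D\<close> for pushouts.
\<close>

definition poset_pullback ::
    "'z rel set \<Rightarrow> 'p rel \<Rightarrow> 'a rel \<Rightarrow> 'b rel \<Rightarrow> 'c rel
      \<Rightarrow> ('p \<Rightarrow> 'a) \<Rightarrow> ('p \<Rightarrow> 'b) \<Rightarrow> ('a \<Rightarrow> 'c) \<Rightarrow> ('b \<Rightarrow> 'c) \<Rightarrow> bool"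
  where "poset_pullback \<Z> P A B C p q f g \<longleftrightarrow>
     p \<in> monotone_maps P A \<and> q \<in> monotone_maps P B \<and>
     f \<in> monotone_maps A C \<and> g \<in> monotone_maps B C \<and>
     compose (Field P) f p = compose (Field P) g q \<and>
     (\<forall>Z\<in>\<Z>. \<forall>a\<in>monotone_maps Z A. \<forall>b\<in>monotone_maps Z B.
        compose (Field Z) f a = compose (Field Z) g b \<longrightarrow>
        (\<exists>!u. u \<in> monotone_maps Z P \<and> compose (Field Z) p u = a \<and> compose (Field Z) q u = b))"

definition poset_pushout ::
    "'z rel set \<Rightarrow> 'a rel \<Rightarrow> 'b rel \<Rightarrow> 'c rel \<Rightarrow> 'd rel
      \<Rightarrow> ('a \<Rightarrow> 'b) \<Rightarrow> ('a \<Rightarrow> 'c) \<Rightarrow> ('b \<Rightarrow> 'd) \<Rightarrow> ('c \<Rightarrow> 'd) \<Rightarrow> bool"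
  where "poset_pushout \<Z> A B C D f g i j \<longleftrightarrow>
     f \<in> monotone_maps A B \<and> g \<in> monotone_maps A C \<and>
     i \<in> monotone_maps B D \<and> j \<in> monotone_maps C D \<and>
     compose (Field A) i f = compose (Field A) j g \<and>
     (\<forall>Z\<in>\<Z>. \<forall>b\<in>monotone_maps B Z. \<forall>c\<in>monotone_maps C Z.
        compose (Field A) b f = compose (Field A) c g \<longrightarrow>
        (\<exists>!u. u \<in> monotone_maps D Z \<and> compose (Field B) u i = b \<and> compose (Field C) u j = c))"

definition finite_chains :: "'a rel \<Rightarrow> 'a set set"
  where "finite_chains P = {C \<in> Chains P. finite C \<and> C \<noteq> {}}"

definition barycentric :: "'a rel \<Rightarrow> 'a set rel"
  where "barycentric P = relation_of (\<subseteq>) (finite_chains P)"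

definition barycentric_map :: "'a rel \<Rightarrow> ('a \<Rightarrow> 'b) \<Rightarrow> 'a set \<Rightarrow> 'b set"
  where "barycentric_map P f = (\<lambda>C\<in>finite_chains P. f ` C)"


section \<open>Metrizable uniform spaces and uniformly continuous maps\<close>

text \<open>
  The library's class \<^class>\<open>uniform_space\<close> only covers whole types, whereas the realizations are
  proper subsets of a function type. Hence a uniform space is represented by its underlying set
  together with its uniformity, the filter of entourages.
\<close>

type_synonym 'a uspace = "'a set \<times> ('a \<times> 'a) filter"

definition metric_uspace :: "'a set \<Rightarrow> ('a \<Rightarrow> 'a \<Rightarrow> real) \<Rightarrow> 'a uspace"
  where "metric_uspace X d =
     (X, INF e\<in>{0<..}. principal {(x, y). x \<in> X \<and> y \<in> X \<and> d x y < e})"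

definition metrizable_uspaces :: "'a uspace set"
  where "metrizable_uspaces = {U. \<exists>X d. Metric_space X d \<and> U = metric_uspace X d}"

definition uniform_maps :: "'a uspace \<Rightarrow> 'b uspace \<Rightarrow> ('a \<Rightarrow> 'b) set"
  where "uniform_maps U V =
     {f \<in> fst U \<rightarrow>\<^sub>E fst V. filterlim (\<lambda>(x, y). (f x, f y)) (snd V) (snd U)}"

definition uspace_pullback ::
    "'z uspace set \<Rightarrow> 'p uspace \<Rightarrow> 'a uspace \<Rightarrow> 'b uspace \<Rightarrow> 'c uspace
      \<Rightarrow> ('p \<Rightarrow> 'a) \<Rightarrow> ('p \<Rightarrow> 'b) \<Rightarrow> ('a \<Rightarrow> 'c) \<Rightarrow> ('b \<Rightarrow> 'c) \<Rightarrow> bool"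
  where "uspace_pullback \<Z> P A B C p q f g \<longleftrightarrow>
     p \<in> uniform_maps P A \<and> q \<in> uniform_maps P B \<and>
     f \<in> uniform_maps A C \<and> g \<in> uniform_maps B C \<and>
     compose (fst P) f p = compose (fst P) g q \<and>
     (\<forall>Z\<in>\<Z>. \<forall>a\<in>uniform_maps Z A. \<forall>b\<in>uniform_maps Z B.
        compose (fst Z) f a = compose (fst Z) g b \<longrightarrow>
        (\<exists>!u. u \<in> uniform_maps Z P \<and> compose (fst Z) p u = a \<and> compose (fst Z) q u = b))"

definition uspace_pushout ::
    "'z uspace set \<Rightarrow> 'a uspace \<Rightarrow> 'b uspace \<Rightarrow> 'c uspace \<Rightarrow> 'd uspace
      \<Rightarrow> ('a \<Rightarrow> 'b) \<Rightarrow> ('a \<Rightarrow> 'c) \<Rightarrow> ('b \<Rightarrow> 'd) \<Rightarrow> ('c \<Rightarrow> 'd) \<Rightarrow> bool"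
  where "uspace_pushout \<Z> A B C D f g i j \<longleftrightarrow>
     f \<in> uniform_maps A B \<and> g \<in> uniform_maps A C \<and>
     i \<in> uniform_maps B D \<and> j \<in> uniform_maps C D \<and>
     compose (fst A) i f = compose (fst A) j g \<and>
     (\<forall>Z\<in>\<Z>. \<forall>b\<in>uniform_maps B Z. \<forall>c\<in>uniform_maps C Z.
        compose (fst A) b f = compose (fst A) c g \<longrightarrow>
        (\<exists>!u. u \<in> uniform_maps D Z \<and> compose (fst B) u i = b \<and> compose (fst C) u j = c))"


section \<open>Geometric realization\<close>

text \<open>
  Elements of \<open>[0,1]\<^sup>P\<close> are represented by functions on the whole type that vanish outside
  \<open>Field P\<close>.
\<close>

definition vertex :: "'a rel \<Rightarrow> 'a \<Rightarrow> 'a \<Rightarrow> real"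
  where "vertex P p = indicator {q \<in> Field P. (q, p) \<in> P}"

definition realization_set :: "'a rel \<Rightarrow> ('a \<Rightarrow> real) set"
  where "realization_set P = (\<Union>C\<in>finite_chains P. convex hull (vertex P ` C))"

definition sup_dist :: "'a rel \<Rightarrow> ('a \<Rightarrow> real) \<Rightarrow> ('a \<Rightarrow> real) \<Rightarrow> real"
  where "sup_dist P f g = (SUP s\<in>Field P. \<bar>f s - g s\<bar>)"

definition realization :: "'a rel \<Rightarrow> ('a \<Rightarrow> real) uspace"
  where "realization P = metric_uspace (realization_set P) (sup_dist P)"

definition realization_map :: "'a rel \<Rightarrow> 'b rel \<Rightarrow> ('a \<Rightarrow> 'b) \<Rightarrow> ('a \<Rightarrow> real) \<Rightarrow> 'b \<Rightarrow> real"
  where "realization_map P Q f = (THE F.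
     F \<in> realization_set P \<rightarrow>\<^sub>E realization_set Q \<and>
     (\<forall>p\<in>Field P. F (vertex P p) = vertex Q (f p)) \<and>
     (\<forall>C\<in>finite_chains P. affine_on (convex hull (vertex P ` C)) F))"

end

theory Submission
  imports Defs
begin

text \<open>
  For \<open>0 < c \<le> 1\<close> the superlevel set \<open>{s. c \<le> x s}\<close> of a point \<open>x\<close> of \<open>|P|\<close> is a principal
  ideal, and \<open>x\<close> is determined by its generators, the level elements of \<open>x\<close>. The map \<open>|f|\<close> applies
  \<open>f\<close> to all level elements. So a pair of points with the same image in \<open>|C|\<close> comes from a unique
  point of the realization of the pullback, namely \<open>s \<mapsto> min (x (p s)) (y (q s))\<close>, which depends on
  \<open>(x, y)\<close> in a 1-Lipschitz way.

  For a pushout that survives subdivision, every finite chain of \<open>D\<close> is the bijective image of a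
  chain of \<open>B\<close> or \<open>C\<close>, and \<open>|i|\<close> is an isometry on the simplex of a chain on which \<open>i\<close> is
  injective. Maps to the two-element chain show that a point of \<open>|D|\<close> whose support is the image of
  a chain \<open>\<kappa>\<close> has a lift in the simplex of \<open>\<kappa>\<close> with the same prescribed value as any given lift;
  for an injectively mapped \<open>\<kappa>\<close> there is only one lift, so the glued map is well defined. It is
  uniformly continuous with the same modulus on each simplex of \<open>|D|\<close>, and any two nearby points of
  \<open>|D|\<close> are joined by three short steps, each inside a simplex.
\<close>

section \<open>Points of the realization and their level elements\<close>

lemma poset_refl: "P \<in> posets \<Longrightarrow> s \<in> Field P \<Longrightarrow> (s, s) \<in> P"
  by (auto simp: posets_def partial_order_on_def preorder_on_def refl_on_def)

lemma poset_trans: "P \<in> posets \<Longrightarrow> (r, s) \<in> P \<Longrightarrow> (s, t) \<in> P \<Longrightarrow> (r, t) \<in> P"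
  by (auto simp: posets_def partial_order_on_def preorder_on_def dest: transD)

lemma poset_antisym: "P \<in> posets \<Longrightarrow> (r, s) \<in> P \<Longrightarrow> (s, r) \<in> P \<Longrightarrow> r = s"
  by (auto simp: posets_def partial_order_on_def dest: antisymD)

lemma finite_chains_Field: "C \<in> finite_chains P \<Longrightarrow> r \<in> C \<Longrightarrow> r \<in> Field P"
  by (auto simp: finite_chains_def Chains_def Field_def)

lemma finite_chains_total:
  "C \<in> finite_chains P \<Longrightarrow> r \<in> C \<Longrightarrow> s \<in> C \<Longrightarrow> (r, s) \<in> P \<or> (s, r) \<in> P"
  by (auto simp: finite_chains_def Chains_def)

lemma finite_chains_subset:
  "C \<in> finite_chains P \<Longrightarrow> S \<subseteq> C \<Longrightarrow> S \<noteq> {} \<Longrightarrow> S \<in> finite_chains P"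
  by (auto simp: finite_chains_def Chains_def intro: finite_subset)

lemma singleton_finite_chain: "P \<in> posets \<Longrightarrow> r \<in> Field P \<Longrightarrow> {r} \<in> finite_chains P"
  using poset_refl by (fastforce simp: finite_chains_def Chains_def)

lemma finite_chain_least:
  assumes P: "P \<in> posets" and C: "C \<in> finite_chains P"
  obtains m where "m \<in> C" "\<And>r. r \<in> C \<Longrightarrow> (m, r) \<in> P"
proof -
  have "finite C" "C \<noteq> {}" using C by (auto simp: finite_chains_def)
  then have "C \<in> finite_chains P \<longrightarrow> (\<exists>m\<in>C. \<forall>r\<in>C. (m, r) \<in> P)"
  proof (induction rule: finite_ne_induct)
    case (singleton r)
    then show ?case using poset_refl[OF P, of r] finite_chains_Field[of "{r}" P r] by simp
  next
    case (insert a F)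
    show ?case
    proof
      assume aF: "insert a F \<in> finite_chains P"
      then have "F \<in> finite_chains P" using insert.hyps by (auto intro: finite_chains_subset)
      then obtain m where m: "m \<in> F" "\<forall>r\<in>F. (m, r) \<in> P" using insert.IH by blast
      have "(a, a) \<in> P" using finite_chains_Field[OF aF] poset_refl[OF P] by simp
      moreover have "(a, m) \<in> P \<or> (m, a) \<in> P" using finite_chains_total[OF aF] m by simp
      ultimately show "\<exists>m\<in>insert a F. \<forall>r\<in>insert a F. (m, r) \<in> P"
        using m poset_trans[OF P] by blast
    qed
  qed
  then show thesis using C that by blast
qed

lemma finite_chain_greatest:
  assumes P: "P \<in> posets" and C: "C \<in> finite_chains P"
  obtains m where "m \<in> C" "\<And>r. r \<in> C \<Longrightarrow> (r, m) \<in> P"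
proof -
  have "P\<inverse> \<in> posets" using P by (simp add: posets_def)
  moreover have "C \<in> finite_chains (P\<inverse>)" using C by (auto simp: finite_chains_def Chains_def)
  ultimately obtain m where "m \<in> C" "\<And>r. r \<in> C \<Longrightarrow> (m, r) \<in> P\<inverse>"
    using finite_chain_least by metis
  then show thesis using that by simp
qed

section \<open>Simplices: convex hulls of the vertices of a chain\<close>

lemma scaleR_fun_apply [simp]: "(c *\<^sub>R f) s = c *\<^sub>R f s"
  by (simp add: scaleR_fun_def)

text \<open>The points of the hull with property \<open>Q\<close> form a convex set containing
  \<open>S\<close>, hence the whole hull. The binary form of the induction matches
  \<open>affine_on\<close>, so no finite sums of coefficients occur.\<close>

lemma convex_hull_induct [consumes 1, case_names vertex convex]:
  assumes "x \<in> convex hull S"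
    and "\<And>v. v \<in> S \<Longrightarrow> Q v"
    and "\<And>x y t. \<lbrakk>x \<in> convex hull S; y \<in> convex hull S; Q x; Q y; 0 \<le> t; t \<le> 1\<rbrakk>
      \<Longrightarrow> Q ((1 - t) *\<^sub>R x + t *\<^sub>R y)"
  shows "Q x"
proof -
  have "convex {x \<in> convex hull S. Q x}"
    using assms(3) convexD_alt[OF convex_convex_hull[of S]]
    by (subst convex_alt) blast
  moreover have "S \<subseteq> {x \<in> convex hull S. Q x}" using assms(2) by (auto simp: hull_inc)
  ultimately have "convex hull S \<subseteq> {x \<in> convex hull S. Q x}" by (rule hull_minimal[rotated])
  then show ?thesis using assms(1) by blast
qed

lemma vertex_apply: "vertex P p s = (if (s, p) \<in> P then 1 else 0)"
  by (auto simp: vertex_def indicator_def Field_def)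

lemma hull_nonneg: "x \<in> convex hull (vertex P ` C) \<Longrightarrow> 0 \<le> x s"
  by (induction rule: convex_hull_induct) (auto simp: vertex_apply)

lemma hull_le_1: "x \<in> convex hull (vertex P ` C) \<Longrightarrow> x s \<le> 1"
  by (induction rule: convex_hull_induct) (auto simp: vertex_apply intro: convex_bound_le)

lemma hull_eq_0:
  "x \<in> convex hull (vertex P ` C) \<Longrightarrow> (\<And>r. r \<in> C \<Longrightarrow> (s, r) \<notin> P) \<Longrightarrow> x s = 0"
  by (induction rule: convex_hull_induct) (auto simp: vertex_apply)

lemma hull_eq_1:
  "x \<in> convex hull (vertex P ` C) \<Longrightarrow> (\<And>r. r \<in> C \<Longrightarrow> (s, r) \<in> P) \<Longrightarrow> x s = 1"
  by (induction rule: convex_hull_induct) (auto simp: vertex_apply)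

text \<open>Each vertex function of the chain that is 1 at \<open>s\<close> is also 1 at
  \<open>s'\<close>, and convex combinations keep the inequality. For \<open>s'\<close> below
  \<open>s\<close> this says that points are antitone; \<open>s'\<close> may also lie above
  \<open>s\<close>, as in the next lemma.\<close>

lemma hull_mono:
  "x \<in> convex hull (vertex P ` C) \<Longrightarrow> (\<And>r. r \<in> C \<Longrightarrow> (s, r) \<in> P \<Longrightarrow> (s', r) \<in> P) \<Longrightarrow> x s \<le> x s'"
  by (induction rule: convex_hull_induct)
    (auto simp: vertex_apply intro!: add_mono mult_left_mono)

text \<open>\<open>m\<close> is the least chain element above \<open>s\<close>, so the same chain
  elements lie above \<open>s\<close> and above \<open>m\<close>. It depends on \<open>s\<close> and
  \<open>C\<close> only, hence serves all points of the simplex at once.\<close>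

lemma hull_eq_eval:
  assumes P: "P \<in> posets" and C: "C \<in> finite_chains P" and s: "r \<in> C" "(s, r) \<in> P"
  obtains m where "m \<in> C" "(s, m) \<in> P" "\<And>x. x \<in> convex hull (vertex P ` C) \<Longrightarrow> x s = x m"
proof -
  have "{r \<in> C. (s, r) \<in> P} \<in> finite_chains P"
    using C s by (intro finite_chains_subset[OF C]) auto
  then obtain m where m: "m \<in> C" "(s, m) \<in> P" "\<And>r. r \<in> C \<Longrightarrow> (s, r) \<in> P \<Longrightarrow> (m, r) \<in> P"
    using finite_chain_least[OF P] by (metis (no_types, lifting) mem_Collect_eq)
  have "x s = x m" if "x \<in> convex hull (vertex P ` C)" for x
    using hull_mono[OF that, of s m] hull_mono[OF that, of m s] m poset_trans[OF P] by fastforce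
  then show thesis using that m by blast
qed

section \<open>Level elements and supports\<close>

definition level :: "'a rel \<Rightarrow> ('a \<Rightarrow> real) \<Rightarrow> real \<Rightarrow> 'a \<Rightarrow> bool"
  where "level P x c p \<longleftrightarrow> p \<in> Field P \<and> (\<forall>s\<in>Field P. c \<le> x s \<longleftrightarrow> (s, p) \<in> P)"

text \<open>For a point of |P| this is the vertex set of the smallest simplex containing it. Heights
  \<open>c <= 0\<close> are excluded because there a greatest element of \<open>P\<close> would
  always count as a level element.\<close>

definition supp :: "'a rel \<Rightarrow> ('a \<Rightarrow> real) \<Rightarrow> 'a set"
  where "supp P x = {p. \<exists>c\<in>{0<..1}. level P x c p}"

lemma levelD: "level P x c p \<Longrightarrow> s \<in> Field P \<Longrightarrow> c \<le> x s \<longleftrightarrow> (s, p) \<in> P"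
  by (simp add: level_def)

lemma level_Field: "level P x c p \<Longrightarrow> p \<in> Field P"
  by (simp add: level_def)

lemma level_self: "P \<in> posets \<Longrightarrow> level P x c p \<Longrightarrow> c \<le> x p"
  using poset_refl by (fastforce simp: level_def)

lemma level_unique:
  assumes "P \<in> posets" "level P x c p" "level P x c q"
  shows "p = q"
proof (rule poset_antisym[OF assms(1)])
  show "(p, q) \<in> P" using assms by (simp add: level_Field level_self flip: levelD[of P x c q])
  show "(q, p) \<in> P" using assms by (simp add: level_Field level_self flip: levelD[of P x c p])
qed

text \<open>From \<open>c <= x p <= x p'\<close> it follows that \<open>p'\<close> lies in the ideal
  of \<open>p\<close>; the heights \<open>c\<close> and \<open>c'\<close> are not compared. So level
  elements are pairwise comparable, in the order opposite to their values.\<close>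

lemma level_order:
  assumes "P \<in> posets" "level P x c p" "level P x c' p'" "x p \<le> x p'"
  shows "(p', p) \<in> P"
  using order_trans[OF level_self[OF assms(1,2)] assms(4)] levelD[OF assms(2) level_Field[OF assms(3)]]
  by blast

text \<open>The least chain element has value 1, so some chain element reaches \<open>c\<close>;
  \<open>p\<close> is the greatest such one. Any \<open>s\<close> with \<open>c <= x s\<close> lies
  below a chain element of the same value, hence below \<open>p\<close>.\<close>

lemma hull_level:
  assumes P: "P \<in> posets" and C: "C \<in> finite_chains P"
    and x: "x \<in> convex hull (vertex P ` C)" and c: "0 < c" "c \<le> 1"
  obtains p where "p \<in> C" "level P x c p"
proof -
  obtain m where m: "m \<in> C" "\<And>r. r \<in> C \<Longrightarrow> (m, r) \<in> P"
    using finite_chain_least[OF P C] by blast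
  have "x m = 1" using hull_eq_1[OF x] m by blast
  then have "{r \<in> C. c \<le> x r} \<in> finite_chains P"
    using m c by (intro finite_chains_subset[OF C]) auto
  then obtain p where p: "p \<in> C" "c \<le> x p" "\<And>r. r \<in> C \<Longrightarrow> c \<le> x r \<Longrightarrow> (r, p) \<in> P"
    using finite_chain_greatest[OF P] by (metis (no_types, lifting) mem_Collect_eq)
  have "c \<le> x s \<longleftrightarrow> (s, p) \<in> P" for s
  proof
    assume cs: "c \<le> x s"
    then have "x s \<noteq> 0" using c by simp
    then obtain r where "r \<in> C" "(s, r) \<in> P" using hull_eq_0[OF x] by blast
    then obtain q where "q \<in> C" "(s, q) \<in> P" "x s = x q"
      using hull_eq_eval[OF P C, of r s] x by blast
    then show "(s, p) \<in> P" using p cs poset_trans[OF P] by metis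
  next
    assume "(s, p) \<in> P"
    then have "x p \<le> x s" using poset_trans[OF P] by (intro hull_mono[OF x]) blast
    then show "c \<le> x s" using p by simp
  qed
  then show thesis using that p finite_chains_Field[OF C] by (simp add: level_def)
qed

lemma hull_finite_range:
  assumes P: "P \<in> posets" and C: "C \<in> finite_chains P"
    and x: "x \<in> convex hull (vertex P ` C)"
  shows "finite (range x)"
proof -
  have "x s \<in> insert 0 (x ` C)" for s
    using hull_eq_0[OF x, of s] hull_eq_eval[OF P C, of _ s] x by (metis imageI insertCI)
  then have "range x \<subseteq> insert 0 (x ` C)" by blast
  then show ?thesis using C by (auto simp: finite_chains_def intro: finite_subset)
qed

lemma realization_setE:
  assumes "x \<in> realization_set P"
  obtains C where "C \<in> finite_chains P" "x \<in> convex hull (vertex P ` C)"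
  using assms by (auto simp: realization_set_def)

lemma hull_subset_realization_set:
  "C \<in> finite_chains P \<Longrightarrow> x \<in> convex hull (vertex P ` C) \<Longrightarrow> x \<in> realization_set P"
  by (auto simp: realization_set_def)

lemma realization_set_nonneg: "x \<in> realization_set P \<Longrightarrow> 0 \<le> x s"
  by (auto elim!: realization_setE hull_nonneg)

lemma realization_set_le_1: "x \<in> realization_set P \<Longrightarrow> x s \<le> 1"
  by (auto elim!: realization_setE hull_le_1)

lemma realization_set_outside:
  assumes "x \<in> realization_set P" "s \<notin> Field P"
  shows "x s = 0"
  using assms by (elim realization_setE) (rule hull_eq_0, auto simp: Field_def)

lemma realization_set_finite_range:
  "P \<in> posets \<Longrightarrow> x \<in> realization_set P \<Longrightarrow> finite (range x)"
  by (auto elim!: realization_setE intro: hull_finite_range)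

lemma realization_set_level:
  assumes "P \<in> posets" "x \<in> realization_set P" "0 < c" "c \<le> 1"
  obtains p where "level P x c p"
  using realization_setE[OF assms(2)] hull_level[OF assms(1) _ _ assms(3,4)] by metis

lemma realization_set_Field: "x \<in> realization_set P \<Longrightarrow> Field P \<noteq> {}"
  using finite_chains_Field by (fastforce elim!: realization_setE simp: finite_chains_def)

lemma vertex_in_realization_set:
  "P \<in> posets \<Longrightarrow> p \<in> Field P \<Longrightarrow> vertex P p \<in> realization_set P"
  by (rule hull_subset_realization_set[OF singleton_finite_chain]) auto

text \<open>Peel off the smallest positive value \<open>v\<close> of \<open>x\<close>, with level element \<open>p\<close>:
  \<open>x = v \<cdot> vertex p + (1 - v) \<cdot> y\<close> for a function \<open>y\<close> that has one positive value less.\<close>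

lemma hull_of_levels:
  assumes P: "P \<in> posets"
    and "finite (range x)" "\<And>s. 0 \<le> x s" "\<And>s. x s \<le> 1" "\<And>s. s \<notin> Field P \<Longrightarrow> x s = 0"
    and "\<And>c. 0 < c \<Longrightarrow> c \<le> 1 \<Longrightarrow> \<exists>p\<in>C. level P x c p"
  shows "x \<in> convex hull (vertex P ` C)"
  using assms(2-)
proof (induction "card (range x - {0})" arbitrary: x rule: less_induct)
  case less
  define V where "V = range x - {0}"
  have fV: "finite V" using less.prems(1) by (simp add: V_def)
  obtain p1 where p1: "p1 \<in> C" "level P x 1 p1" using less.prems(5)[of 1] by auto
  have "x p1 = 1" using level_self[OF P p1(2)] less.prems(3)[of p1] by simp
  then have V1: "1 \<in> V" unfolding V_def by (metis Diff_iff rangeI singletonD zero_neq_one)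
  define v where "v = Min V"
  have vV: "v \<in> V" unfolding v_def using fV V1 by (intro Min_in) auto
  have v_le: "v \<le> x s" if "x s \<noteq> 0" for s
    unfolding v_def using fV that by (auto simp: V_def)
  have v0: "0 < v" using vV less.prems(2) by (auto simp: V_def order_less_le)
  have v1: "v \<le> 1" using vV less.prems(3) by (auto simp: V_def)
  obtain p where p: "p \<in> C" "level P x v p" using less.prems(5) v0 v1 by blast
  have lev: "v \<le> x s \<longleftrightarrow> (s, p) \<in> P" for s
  proof (cases "s \<in> Field P")
    case True
    then show ?thesis using levelD[OF p(2)] by blast
  next
    case False
    then have "(s, p) \<notin> P" by (auto simp: Field_def)
    then show ?thesis using False less.prems(4)[of s] v0 by simp
  qed
  have vp: "vertex P p \<in> convex hull (vertex P ` C)" using p(1) by (simp add: hull_inc)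
  show ?case
  proof (cases "v = 1")
    case True
    \<comment> \<open>If the smallest positive value is 1, then \<open>x\<close> is the
      characteristic function of its superlevel set at 1, the ideal of \<open>p\<close>.\<close>
    have "x s = vertex P p s" for s
      using lev[of s] v_le[of s] less.prems(3)[of s] True by (auto simp: vertex_apply)
    then show ?thesis using vp by (metis ext)
  next
    case False
    with v1 have v1: "v < 1" by simp
    \<comment> \<open>The affine map sending \<open>v\<close> to 0 and 1 to 1, applied to the
      positive values. The value 0 is treated separately, as it would become negative.\<close>
    define y where "y = (\<lambda>s. if x s = 0 then 0 else (x s - v) / (1 - v))"
    have y0: "0 \<le> y s" for s using v_le[of s] v1 by (auto simp: y_def)
    have y1: "y s \<le> 1" for s using less.prems(3)[of s] v1 by (auto simp: y_def)
    \<comment> \<open>Superlevel sets of \<open>y\<close> are superlevel sets of \<open>x\<close> at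
      rescaled heights, so \<open>y\<close> inherits the level elements in \<open>C\<close>.\<close>
    have y_lev: "c \<le> y s \<longleftrightarrow> v + c * (1 - v) \<le> x s" if "0 < c" for c s
    proof -
      have "0 < v + c * (1 - v)" using that v0 v1 by (intro add_pos_pos mult_pos_pos) auto
      then show ?thesis
        using that v0 v1 by (cases "x s = 0") (auto simp: y_def pos_le_divide_eq)
    qed
    \<comment> \<open>The value \<open>v\<close> has turned into 0, so the nonzero values of
      \<open>y\<close> come from the remaining elements of \<open>V\<close>; this makes the
      induction measure drop.\<close>
    have "y s \<in> (\<lambda>a. (a - v) / (1 - v)) ` (V - {v})" if "y s \<noteq> 0" for s
      using that by (auto simp: y_def V_def split: if_splits)
    then have ysub: "range y - {0} \<subseteq> (\<lambda>a. (a - v) / (1 - v)) ` (V - {v})" by auto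
    have "card (range y - {0}) \<le> card ((\<lambda>a. (a - v) / (1 - v)) ` (V - {v}))"
      using ysub fV by (intro card_mono) auto
    also have "\<dots> \<le> card (V - {v})" using fV by (intro card_image_le) auto
    also have "\<dots> < card V" using fV vV by (metis card_Diff1_less)
    finally have card: "card (range y - {0}) < card (range x - {0})" by (simp add: V_def)
    have "finite (range y - {0})" using ysub fV by (meson finite_surj finite_Diff)
    then have fy: "finite (range y)" by simp
    have "\<exists>p\<in>C. level P y c p" if c: "0 < c" "c \<le> 1" for c
    proof -
      have "0 < v + c * (1 - v)" using c v0 v1 by (intro add_pos_pos mult_pos_pos) auto
      moreover have "v + c * (1 - v) \<le> 1"
        using convex_bound_le[of 1 1 c v "1 - v"] c v0 v1 by (simp add: mult.commute)
      ultimately show ?thesis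
        using less.prems(5)[of "v + c * (1 - v)"] y_lev[OF c(1)] by (simp add: level_def)
    qed
    then have "y \<in> convex hull (vertex P ` C)"
      using less.prems(4) by (intro less.hyps[OF card fy y0 y1]) (auto simp: y_def)
    then have "(1 - v) *\<^sub>R y + v *\<^sub>R vertex P p \<in> convex hull (vertex P ` C)"
      using vp v0 v1 by (intro convexD_alt) auto
    moreover have "((1 - v) *\<^sub>R y + v *\<^sub>R vertex P p) s = x s" for s
      using lev[of s] v_le[of s] v1 v0 by (auto simp: y_def vertex_apply)
    ultimately show ?thesis by (metis ext)
  qed
qed

text \<open>By \<open>level_order\<close> the support is a chain on which \<open>x\<close> is
  injective, so it is finite because \<open>x\<close> has finitely many values. The given level
  element makes it nonempty.\<close>

lemma supp_finite_chain:
  assumes P: "P \<in> posets" and "finite (range x)" and "level P x c p" "0 < c" "c \<le> 1"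
  shows "supp P x \<in> finite_chains P"
proof -
  have ord: "(q, p) \<in> P" if "p \<in> supp P x" "q \<in> supp P x" "x p \<le> x q" for p q
    using that level_order[OF P] by (auto simp: supp_def)
  have "inj_on x (supp P x)" using ord poset_antisym[OF P] by (intro inj_onI) simp
  moreover have "finite (x ` supp P x)" using assms(2) by (rule finite_subset[rotated]) auto
  ultimately have "finite (supp P x)" by (rule finite_imageD[rotated])
  moreover have "p \<in> supp P x"
    unfolding supp_def using assms(3-) by (intro CollectI bexI[of _ c]) auto
  moreover have "supp P x \<in> Chains P" using ord by (auto simp: Chains_def) (meson linear)
  ultimately show ?thesis by (auto simp: finite_chains_def)
qed

lemma realization_set_supp:
  assumes P: "P \<in> posets" and x: "x \<in> realization_set P"
  shows "supp P x \<in> finite_chains P"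
  using realization_set_level[OF P x, of 1] supp_finite_chain[OF P realization_set_finite_range[OF P x]]
  by (metis zero_less_one order_refl)

lemma realization_set_hull_supp:
  assumes P: "P \<in> posets" and x: "x \<in> realization_set P"
  shows "x \<in> convex hull (vertex P ` supp P x)"
  using x realization_set_level[OF P x]
  by (intro hull_of_levels[OF P realization_set_finite_range[OF P x]])
    (auto simp: realization_set_nonneg realization_set_le_1 realization_set_outside supp_def
      intro: realization_set_outside, meson greaterThanAtMost_iff)

text \<open>The intrinsic description of |P|, without simplices: finitely many values, and principal
  ideals as superlevel sets. Points can then be built from their levels, as is done for
  pullbacks.\<close>

lemma realization_setI:
  assumes P: "P \<in> posets"
    and "finite (range x)" "\<And>s. 0 \<le> x s" "\<And>s. x s \<le> 1" "\<And>s. s \<notin> Field P \<Longrightarrow> x s = 0"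
    and lev: "\<And>c. 0 < c \<Longrightarrow> c \<le> 1 \<Longrightarrow> \<exists>p. level P x c p"
  shows "x \<in> realization_set P"
proof -
  obtain p where "level P x 1 p" using lev[of 1] by auto
  then have "supp P x \<in> finite_chains P" using supp_finite_chain[OF P assms(2)] by force
  moreover have "x \<in> convex hull (vertex P ` supp P x)"
    using assms by (intro hull_of_levels) (auto simp: supp_def, meson greaterThanAtMost_iff)
  ultimately show ?thesis by (rule hull_subset_realization_set)
qed

text \<open>A value in [0,1] is determined by the heights in (0,1] that it reaches; testing
  \<open>c = x s\<close> and \<open>c = y s\<close> suffices.\<close>

lemma realization_set_eqI:
  assumes P: "P \<in> posets" and x: "x \<in> realization_set P" and y: "y \<in> realization_set P"
    and lev: "\<And>c. 0 < c \<Longrightarrow> c \<le> 1 \<Longrightarrow> \<exists>p. level P x c p \<and> level P y c p"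
  shows "x = y"
proof
  fix s
  show "x s = y s"
  proof (cases "s \<in> Field P")
    case True
    then have "c \<le> x s \<longleftrightarrow> c \<le> y s" if "0 < c" "c \<le> 1" for c
      using lev[OF that] by (auto simp: level_def)
    from this[of "x s"] this[of "y s"] show ?thesis
      using realization_set_nonneg[OF x, of s] realization_set_nonneg[OF y, of s]
        realization_set_le_1[OF x, of s] realization_set_le_1[OF y, of s] by linarith
  qed (use x y in \<open>simp add: realization_set_outside\<close>)
qed

section \<open>The realization of a monotone map\<close>

lemma monotone_maps_Field: "f \<in> monotone_maps P Q \<Longrightarrow> p \<in> Field P \<Longrightarrow> f p \<in> Field Q"
  by (auto simp: monotone_maps_def)

lemma monotone_mapsD: "f \<in> monotone_maps P Q \<Longrightarrow> (p, q) \<in> P \<Longrightarrow> (f p, f q) \<in> Q"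
  by (simp add: monotone_maps_def monotone_on_def FieldI1 FieldI2)

lemma monotone_mapsI:
  "\<lbrakk>f \<in> extensional (Field P); \<And>p. p \<in> Field P \<Longrightarrow> f p \<in> Field Q;
    \<And>p q. (p, q) \<in> P \<Longrightarrow> (f p, f q) \<in> Q\<rbrakk> \<Longrightarrow> f \<in> monotone_maps P Q"
  by (auto simp: monotone_maps_def monotone_on_def PiE_def)

lemma compose_monotone_maps:
  assumes "f \<in> monotone_maps P Q" "g \<in> monotone_maps Q R"
  shows "compose (Field P) g f \<in> monotone_maps P R"
proof (rule monotone_mapsI)
  show "compose (Field P) g f p \<in> Field R" if "p \<in> Field P" for p
    using assms that by (simp add: compose_eq monotone_maps_Field)
  show "(compose (Field P) g f p, compose (Field P) g f q) \<in> R" if "(p, q) \<in> P" for p q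
    using assms that by (simp add: compose_eq monotone_mapsD FieldI1 FieldI2)
qed (rule compose_extensional)

lemma identity_monotone_map: "(\<lambda>x\<in>Field P. x) \<in> monotone_maps P P"
  by (rule monotone_mapsI) (auto simp: FieldI1 FieldI2)

lemma finite_chains_image:
  assumes f: "f \<in> monotone_maps P Q" and C: "C \<in> finite_chains P"
  shows "f ` C \<in> finite_chains Q"
  using C monotone_mapsD[OF f] by (fastforce simp: finite_chains_def Chains_def)

text \<open>The formula for \<open>|f|\<close> comes from \<open>{s. c \<le> |f| x s} = {s. s \<le> f p}\<close> for the level element \<open>p\<close>
  of \<open>x\<close> at height \<open>c\<close>; the \<open>0\<close> covers an empty supremum.\<close>

definition extension :: "'a rel \<Rightarrow> 'b rel \<Rightarrow> ('a \<Rightarrow> 'b) \<Rightarrow> ('a \<Rightarrow> real) \<Rightarrow> 'b \<Rightarrow> real"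
  where "extension P Q f x s = Sup (insert 0 (x ` {p \<in> Field P. (s, f p) \<in> Q}))"

text \<open>\<open>m\<close> is the least chain element whose image lies above \<open>s\<close>. The
  case and \<open>m\<close> depend on \<open>s\<close> and \<open>C\<close> only, so on a simplex
  each coordinate of the extension is a fixed coordinate evaluation or constantly 0. This is where
  affinity comes from.\<close>

lemma extension_cases:
  assumes P: "P \<in> posets" and Q: "Q \<in> posets" and f: "f \<in> monotone_maps P Q"
    and C: "C \<in> finite_chains P"
  obtains (eval) m where "m \<in> C" "(s, f m) \<in> Q" "\<And>r. r \<in> C \<Longrightarrow> (s, f r) \<in> Q \<Longrightarrow> (m, r) \<in> P"
      "\<And>x. x \<in> convex hull (vertex P ` C) \<Longrightarrow> extension P Q f x s = x m"
  | (zero) "\<And>r. r \<in> C \<Longrightarrow> (s, f r) \<notin> Q"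
      "\<And>x. x \<in> convex hull (vertex P ` C) \<Longrightarrow> extension P Q f x s = 0"
proof (cases "\<exists>r\<in>C. (s, f r) \<in> Q")
  case True
  then have "{r \<in> C. (s, f r) \<in> Q} \<in> finite_chains P"
    by (intro finite_chains_subset[OF C]) auto
  then obtain m where m: "m \<in> C" "(s, f m) \<in> Q"
      "\<And>r. r \<in> C \<Longrightarrow> (s, f r) \<in> Q \<Longrightarrow> (m, r) \<in> P"
    using finite_chain_least[OF P] by (metis (no_types, lifting) mem_Collect_eq)
  have "extension P Q f x s = x m" if x: "x \<in> convex hull (vertex P ` C)" for x
    unfolding extension_def
  proof (rule cSup_eq_maximum)
    show "x m \<in> insert 0 (x ` {p \<in> Field P. (s, f p) \<in> Q})"
      using m finite_chains_Field[OF C] by blast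
    \<comment> \<open>A chain element \<open>r\<close> above such a \<open>p\<close> satisfies
      \<open>s <= f p <= f r\<close>, so it lies above \<open>m\<close>, and
      \<open>hull_mono\<close> applies.\<close>
    have "x p \<le> x m" if "(s, f p) \<in> Q" for p
      using m(3) that poset_trans[OF Q] monotone_mapsD[OF f] by (intro hull_mono[OF x]) blast
    then show "y \<le> x m" if "y \<in> insert 0 (x ` {p \<in> Field P. (s, f p) \<in> Q})" for y
      using that hull_nonneg[OF x] by auto
  qed
  with m show thesis using eval by blast
next
  case False
  have "extension P Q f x s = 0" if x: "x \<in> convex hull (vertex P ` C)" for x
    unfolding extension_def
  proof (rule cSup_eq_maximum)
    \<comment> \<open>A chain element above such a \<open>p\<close> would have an image above
      \<open>s\<close>, contrary to the case assumption.\<close>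
    have "x p = 0" if "(s, f p) \<in> Q" for p
      using False that poset_trans[OF Q] monotone_mapsD[OF f] by (intro hull_eq_0[OF x]) blast
    then show "y \<le> 0" if "y \<in> insert 0 (x ` {p \<in> Field P. (s, f p) \<in> Q})" for y
      using that by auto
  qed simp
  with False show thesis using zero by blast
qed

lemma extension_vertex:
  assumes "P \<in> posets" "Q \<in> posets" "f \<in> monotone_maps P Q" "p \<in> Field P"
  shows "extension P Q f (vertex P p) = vertex Q (f p)"
proof
  fix s
  have p: "{p} \<in> finite_chains P" using assms by (simp add: singleton_finite_chain)
  have "vertex P p \<in> convex hull (vertex P ` {p})" by simp
  then show "extension P Q f (vertex P p) s = vertex Q (f p) s"
    using extension_cases[OF assms(1-3) p, of s "extension P Q f (vertex P p) s = vertex Q (f p) s"]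
      poset_refl[OF assms(1,4)]
    by (auto simp: vertex_apply)
qed

lemma extension_affine:
  assumes "P \<in> posets" "Q \<in> posets" "f \<in> monotone_maps P Q" "C \<in> finite_chains P"
  shows "affine_on (convex hull (vertex P ` C)) (extension P Q f)"
  unfolding affine_on_def
proof (intro ballI ext)
  fix x y t s
  assume xy: "x \<in> convex hull (vertex P ` C)" "y \<in> convex hull (vertex P ` C)" "t \<in> {0..1::real}"
  then have "(1 - t) *\<^sub>R x + t *\<^sub>R y \<in> convex hull (vertex P ` C)" by (intro convexD_alt) auto
  then show "extension P Q f ((1 - t) *\<^sub>R x + t *\<^sub>R y) s
      = ((1 - t) *\<^sub>R extension P Q f x + t *\<^sub>R extension P Q f y) s"
    using xy by (cases rule: extension_cases[OF assms, of s]) auto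
qed

lemma affine_on_image_hull:
  assumes F: "affine_on (convex hull S) F"
  shows "F ` (convex hull S) = convex hull (F ` S)"
proof
  have "F x \<in> convex hull (F ` S)" if "x \<in> convex hull S" for x
    using that
  proof (induction rule: convex_hull_induct)
    case (vertex v)
    then show ?case by (simp add: hull_inc)
  next
    case (convex x y t)
    then have "F ((1 - t) *\<^sub>R x + t *\<^sub>R y) = (1 - t) *\<^sub>R F x + t *\<^sub>R F y"
      using F by (simp add: affine_on_def)
    then show ?case using convex by (simp add: convexD_alt)
  qed
  then show "F ` (convex hull S) \<subseteq> convex hull (F ` S)" by blast
  have "convex (F ` (convex hull S))"
  proof (subst convex_alt, clarify)
    fix x y and t :: real
    assume xy: "x \<in> convex hull S" "y \<in> convex hull S" "0 \<le> t" "t \<le> 1"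
    then have "(1 - t) *\<^sub>R F x + t *\<^sub>R F y = F ((1 - t) *\<^sub>R x + t *\<^sub>R y)"
      using F by (simp add: affine_on_def)
    then show "(1 - t) *\<^sub>R F x + t *\<^sub>R F y \<in> F ` (convex hull S)"
      using xy by (simp add: convexD_alt)
  qed
  then show "convex hull (F ` S) \<subseteq> F ` (convex hull S)"
    by (intro hull_minimal) (auto simp: hull_inc)
qed

lemma extension_image_hull:
  assumes "P \<in> posets" "Q \<in> posets" "f \<in> monotone_maps P Q" "C \<in> finite_chains P"
  shows "extension P Q f ` (convex hull (vertex P ` C)) = convex hull (vertex Q ` f ` C)"
proof -
  have "extension P Q f ` vertex P ` C = vertex Q ` f ` C"
    unfolding image_image
    by (intro image_cong refl extension_vertex[OF assms(1-3)] finite_chains_Field[OF assms(4)])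
  then show ?thesis by (simp add: affine_on_image_hull[OF extension_affine[OF assms]])
qed

lemma extension_in_realization_set:
  assumes "P \<in> posets" "Q \<in> posets" "f \<in> monotone_maps P Q" "x \<in> realization_set P"
  shows "extension P Q f x \<in> realization_set Q"
  using assms(4)
proof (rule realization_setE)
  fix C assume C: "C \<in> finite_chains P" "x \<in> convex hull (vertex P ` C)"
  then have "extension P Q f x \<in> convex hull (vertex Q ` f ` C)"
    using extension_image_hull[OF assms(1-3) C(1)] by blast
  then show ?thesis
    by (rule hull_subset_realization_set[OF finite_chains_image[OF assms(3) C(1)]])
qed

lemma affine_on_hull_eqI:
  assumes F: "affine_on (convex hull S) F" and G: "affine_on (convex hull S) G"
    and eq: "\<And>v. v \<in> S \<Longrightarrow> F v = G v" and x: "x \<in> convex hull S"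
  shows "F x = G x"
  using x
proof (induction rule: convex_hull_induct)
  case (convex x y t)
  then show ?case using F G by (simp add: affine_on_def)
qed (rule eq)

text \<open>This resolves the definite description: \<open>extension\<close> satisfies its
  conditions, and affine maps that agree on the vertices of a chain agree on its simplex.\<close>

lemma realization_map_eq:
  assumes "P \<in> posets" "Q \<in> posets" "f \<in> monotone_maps P Q"
  shows "realization_map P Q f = restrict (extension P Q f) (realization_set P)"
  unfolding realization_map_def
proof (rule the_equality, intro conjI ballI)
  \<comment> \<open>A simplex and all convex combinations of its points lie in the realization, so
    the restriction does not disturb affinity.\<close>
  have hull: "affine_on (convex hull (vertex P ` C)) (restrict F (realization_set P)) \<longleftrightarrow>
      affine_on (convex hull (vertex P ` C)) F"
    if C: "C \<in> finite_chains P" for C and F :: "('a \<Rightarrow> real) \<Rightarrow> 'b \<Rightarrow> real"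
    using hull_subset_realization_set[OF C] convexD_alt[OF convex_convex_hull[of "vertex P ` C"]]
    by (simp add: affine_on_def)
  show "restrict (extension P Q f) (realization_set P) \<in> realization_set P \<rightarrow>\<^sub>E realization_set Q"
    using extension_in_realization_set[OF assms] by auto
  show "restrict (extension P Q f) (realization_set P) (vertex P p) = vertex Q (f p)"
    if "p \<in> Field P" for p
    using that assms by (simp add: vertex_in_realization_set extension_vertex)
  show "affine_on (convex hull (vertex P ` C)) (restrict (extension P Q f) (realization_set P))"
    if "C \<in> finite_chains P" for C
    using hull[OF that] extension_affine[OF assms that] by blast
  fix F
  assume F: "F \<in> realization_set P \<rightarrow>\<^sub>E realization_set Q \<and>
    (\<forall>p\<in>Field P. F (vertex P p) = vertex Q (f p)) \<and>
    (\<forall>C\<in>finite_chains P. affine_on (convex hull (vertex P ` C)) F)"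
  show "F = restrict (extension P Q f) (realization_set P)"
  proof (rule extensionalityI[of _ "realization_set P"])
    fix x assume x: "x \<in> realization_set P"
    then obtain C where C: "C \<in> finite_chains P" "x \<in> convex hull (vertex P ` C)"
      by (rule realization_setE)
    have "F x = extension P Q f x"
      using F C(1) finite_chains_Field[OF C(1)]
      by (intro affine_on_hull_eqI[OF _ extension_affine[OF assms C(1)] _ C(2)])
        (auto simp: extension_vertex[OF assms])
    then show "F x = restrict (extension P Q f) (realization_set P) x" using x by simp
  qed (use F in \<open>auto simp: PiE_def\<close>)
qed

lemma realization_map_apply:
  assumes "P \<in> posets" "Q \<in> posets" "f \<in> monotone_maps P Q" "x \<in> realization_set P"
  shows "realization_map P Q f x = extension P Q f x"
  using assms by (simp add: realization_map_eq)

lemma realization_map_in: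
  assumes "P \<in> posets" "Q \<in> posets" "f \<in> monotone_maps P Q" "x \<in> realization_set P"
  shows "realization_map P Q f x \<in> realization_set Q"
  using assms by (simp add: realization_map_apply extension_in_realization_set)

lemma realization_map_image_hull:
  assumes "P \<in> posets" "Q \<in> posets" "f \<in> monotone_maps P Q" "C \<in> finite_chains P"
  shows "realization_map P Q f ` (convex hull (vertex P ` C)) = convex hull (vertex Q ` f ` C)"
  using extension_image_hull[OF assms] hull_subset_realization_set[OF assms(4)]
    realization_map_apply[OF assms(1-3)]
  by (metis (no_types, lifting) image_cong)

section \<open>Action on level elements and functoriality\<close>

lemma realization_map_ge:
  assumes "P \<in> posets" "Q \<in> posets" "f \<in> monotone_maps P Q" "x \<in> realization_set P"
    and "(s, f p) \<in> Q" "p \<in> Field P"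
  shows "x p \<le> realization_map P Q f x s"
proof -
  have "bdd_above (insert 0 (x ` {p \<in> Field P. (s, f p) \<in> Q}))"
    using realization_set_le_1[OF assms(4)] by (intro bdd_aboveI[of _ 1]) auto
  then show ?thesis
    using assms(5,6) unfolding realization_map_apply[OF assms(1-4)] extension_def
    by (intro cSup_upper) auto
qed

text \<open>On a simplex the supremum is a maximum. The value 0 is excluded because it may come from
  the added 0, with no element of \<open>P\<close> mapped above \<open>s\<close>.\<close>

lemma realization_map_attained:
  assumes "P \<in> posets" "Q \<in> posets" "f \<in> monotone_maps P Q" "x \<in> realization_set P"
    and "realization_map P Q f x s \<noteq> 0"
  obtains p where "p \<in> Field P" "(s, f p) \<in> Q" "realization_map P Q f x s = x p"
  using assms(4)
proof (rule realization_setE)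
  fix C assume C: "C \<in> finite_chains P" "x \<in> convex hull (vertex P ` C)"
  show thesis
    using extension_cases[OF assms(1-3) C(1), of s thesis] C assms(5)
      realization_map_apply[OF assms(1-4)] finite_chains_Field[OF C(1)] that
    by metis
qed

text \<open>\<open>|f| x\<close> reaches \<open>c\<close> at \<open>s\<close> exactly if some
  \<open>q\<close> with \<open>s <= f q\<close> satisfies \<open>c <= x q\<close>, that is
  \<open>q <= p\<close>; by monotonicity this amounts to \<open>s <= f p\<close>. Nearly all later
  facts about realized maps are read off from this.\<close>

lemma realization_map_level:
  assumes "P \<in> posets" "Q \<in> posets" "f \<in> monotone_maps P Q" "x \<in> realization_set P"
    and p: "level P x c p" and c: "0 < c"
  shows "level Q (realization_map P Q f x) c (f p)"
  unfolding level_def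
proof (intro conjI ballI iffI)
  show "f p \<in> Field Q" using level_Field[OF p] by (rule monotone_maps_Field[OF assms(3)])
next
  fix s assume cs: "c \<le> realization_map P Q f x s"
  then have "realization_map P Q f x s \<noteq> 0" using c by linarith
  then obtain q where q: "q \<in> Field P" "(s, f q) \<in> Q" "realization_map P Q f x s = x q"
    by (rule realization_map_attained[OF assms(1-4)])
  then have "(q, p) \<in> P" using levelD[OF p] cs by simp
  with q(2) show "(s, f p) \<in> Q" using monotone_mapsD[OF assms(3)] poset_trans[OF assms(2)] by blast
next
  fix s assume "(s, f p) \<in> Q"
  then have "x p \<le> realization_map P Q f x s"
    using realization_map_ge[OF assms(1-4)] level_Field[OF p] by blast
  then show "c \<le> realization_map P Q f x s" using level_self[OF assms(1) p] by linarith
qed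

lemma realization_map_supp:
  assumes "P \<in> posets" "Q \<in> posets" "f \<in> monotone_maps P Q" "x \<in> realization_set P"
  shows "supp Q (realization_map P Q f x) = f ` supp P x"
proof (intro equalityI subsetI)
  fix r assume "r \<in> supp Q (realization_map P Q f x)"
  then obtain c where c: "0 < c" "c \<le> 1" "level Q (realization_map P Q f x) c r"
    by (auto simp: supp_def)
  then obtain p where p: "level P x c p" using realization_set_level[OF assms(1,4)] by blast
  then have "r = f p"
    using level_unique[OF assms(2) c(3)] realization_map_level[OF assms p c(1)] by blast
  moreover have "p \<in> supp P x" using p c by (auto simp: supp_def)
  ultimately show "r \<in> f ` supp P x" by blast
next
  fix r assume "r \<in> f ` supp P x"
  then show "r \<in> supp Q (realization_map P Q f x)"
    using realization_map_level[OF assms] by (force simp: supp_def)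
qed

lemma realization_map_identity:
  assumes P: "P \<in> posets"
  shows "realization_map P P (\<lambda>x\<in>Field P. x) = (\<lambda>x\<in>realization_set P. x)"
proof (rule extensionalityI[of _ "realization_set P"])
  note id = P P identity_monotone_map
  fix x assume x: "x \<in> realization_set P"
  have "realization_map P P (\<lambda>x\<in>Field P. x) x = x"
  proof (rule realization_set_eqI[OF P realization_map_in[OF id x] x])
    fix c :: real assume c: "0 < c" "c \<le> 1"
    obtain p where p: "level P x c p" using realization_set_level[OF P x c] .
    then show "\<exists>p. level P (realization_map P P (\<lambda>x\<in>Field P. x) x) c p \<and> level P x c p"
      using realization_map_level[OF id x p c(1)] level_Field[OF p] by auto
  qed
  then show "realization_map P P (\<lambda>x\<in>Field P. x) x = (\<lambda>x\<in>realization_set P. x) x" using x by simp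
qed (simp_all add: realization_map_eq[OF P P identity_monotone_map])

text \<open>If \<open>p\<close> is the level element of \<open>x\<close> at height \<open>c\<close>,
  both sides have the level element \<open>g (f p)\<close> there, and level elements determine a
  point.\<close>

lemma realization_map_compose_apply:
  assumes "P \<in> posets" "Q \<in> posets" "R \<in> posets"
    and f: "f \<in> monotone_maps P Q" and g: "g \<in> monotone_maps Q R" and x: "x \<in> realization_set P"
  shows "realization_map P R (compose (Field P) g f) x = realization_map Q R g (realization_map P Q f x)"
proof -
  note f' = assms(1,2) f and g' = assms(2,3) g
  note gf = assms(1,3) compose_monotone_maps[OF f g]
  show ?thesis
  proof (rule realization_set_eqI[OF assms(3) realization_map_in[OF gf x]
        realization_map_in[OF g' realization_map_in[OF f' x]]])
    fix c :: real assume c: "0 < c" "c \<le> 1"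
    obtain p where p: "level P x c p" using realization_set_level[OF assms(1) x c] .
    have "level R (realization_map P R (compose (Field P) g f) x) c (g (f p))"
      using realization_map_level[OF gf x p c(1)] level_Field[OF p] by (simp add: compose_eq)
    then show "\<exists>p. level R (realization_map P R (compose (Field P) g f) x) c p \<and>
        level R (realization_map Q R g (realization_map P Q f x)) c p"
      using realization_map_level[OF g' realization_map_in[OF f' x]
          realization_map_level[OF f' x p c(1)] c(1)] by blast
  qed
qed

lemma realization_map_compose:
  assumes "P \<in> posets" "Q \<in> posets" "R \<in> posets"
    and f: "f \<in> monotone_maps P Q" and g: "g \<in> monotone_maps Q R"
  shows "realization_map P R (compose (Field P) g f) =
    compose (realization_set P) (realization_map Q R g) (realization_map P Q f)"
proof (rule extensionalityI[of _ "realization_set P"])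
  fix x assume "x \<in> realization_set P"
  then show "realization_map P R (compose (Field P) g f) x =
      compose (realization_set P) (realization_map Q R g) (realization_map P Q f) x"
    using realization_map_compose_apply[OF assms] by (simp add: compose_eq)
qed (simp_all add: realization_map_eq[OF assms(1,3) compose_monotone_maps[OF f g]] compose_extensional)

section \<open>The metric\<close>

text \<open>Coordinate differences are bounded by 1, so the supremum is a genuine upper bound.
  Outside \<open>Field P\<close> both points vanish, and a coordinate inside shows that the distance
  is nonnegative. Since \<open>s\<close> is arbitrary, any instance, such as
  \<open>undefined\<close>, yields nonnegativity.\<close>

lemma sup_dist_ge:
  assumes "x \<in> realization_set P" "y \<in> realization_set P"
  shows "\<bar>x s - y s\<bar> \<le> sup_dist P x y"
proof (cases "s \<in> Field P")
  case True
  have "\<bar>x s - y s\<bar> \<le> 1" for s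
    using assms[THEN realization_set_nonneg, of s] assms[THEN realization_set_le_1, of s] by linarith
  then show ?thesis unfolding sup_dist_def
    using True by (intro cSUP_upper bdd_aboveI[of _ 1]) auto
next
  case False
  obtain r where "r \<in> Field P" using realization_set_Field[OF assms(1)] by blast
  have "\<bar>x s - y s\<bar> \<le> 1" for s
    using assms[THEN realization_set_nonneg, of s] assms[THEN realization_set_le_1, of s] by linarith
  then have "\<bar>x r - y r\<bar> \<le> sup_dist P x y" unfolding sup_dist_def
    using \<open>r \<in> Field P\<close> by (intro cSUP_upper bdd_aboveI[of _ 1]) auto
  then show ?thesis using False assms by (simp add: realization_set_outside)
qed

lemma sup_dist_le:
  assumes "x \<in> realization_set P" "\<And>s. s \<in> Field P \<Longrightarrow> \<bar>x s - y s\<bar> \<le> e"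
  shows "sup_dist P x y \<le> e"
  unfolding sup_dist_def using realization_set_Field[OF assms(1)] assms(2) by (intro cSUP_least) auto

lemma metric_uspace_cong:
  assumes "\<And>x y. x \<in> X \<Longrightarrow> y \<in> X \<Longrightarrow> d x y = e x y"
  shows "metric_uspace X d = metric_uspace X e"
proof -
  have "{(x, y). x \<in> X \<and> y \<in> X \<and> d x y < r} = {(x, y). x \<in> X \<and> y \<in> X \<and> e x y < r}" for r
    using assms by auto
  then show ?thesis by (simp add: metric_uspace_def)
qed

text \<open>\<^const>\<open>Metric_space\<close> requires nonnegativity and symmetry off the underlying set as well,
  where \<^const>\<open>sup_dist\<close> may be an unspecified supremum.\<close>

lemma realization_metrizable: "realization P \<in> metrizable_uspaces"
proof -
  let ?X = "realization_set P"
  let ?d = "\<lambda>x y. if x \<in> ?X \<and> y \<in> ?X then sup_dist P x y else 0"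
  have nonneg: "0 \<le> sup_dist P x y" if "x \<in> ?X" "y \<in> ?X" for x y
    using sup_dist_ge[OF that, of undefined] by linarith
  have "Metric_space ?X ?d"
  proof
    show "0 \<le> ?d x y" for x y using nonneg by simp
    show "?d x y = ?d y x" for x y by (simp add: sup_dist_def abs_minus_commute)
    show "?d x y = 0 \<longleftrightarrow> x = y" if xy: "x \<in> ?X" "y \<in> ?X" for x y
    proof
      assume "?d x y = 0"
      then show "x = y" using sup_dist_ge[OF xy] xy by (intro ext) (simp add: order_antisym)
    next
      assume "x = y"
      then show "?d x y = 0" using sup_dist_le[OF xy(1), of y 0] nonneg[OF xy] by simp
    qed
    show "?d x z \<le> ?d x y + ?d y z" if xyz: "x \<in> ?X" "y \<in> ?X" "z \<in> ?X" for x y z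
    proof -
      have "sup_dist P x z \<le> sup_dist P x y + sup_dist P y z"
      proof (rule sup_dist_le[OF xyz(1)])
        fix s
        show "\<bar>x s - z s\<bar> \<le> sup_dist P x y + sup_dist P y z"
          using sup_dist_ge[OF xyz(1,2), of s] sup_dist_ge[OF xyz(2,3), of s] by linarith
      qed
      then show ?thesis using xyz by simp
    qed
  qed
  moreover have "realization P = metric_uspace ?X ?d"
    unfolding realization_def by (rule metric_uspace_cong) simp
  ultimately show ?thesis unfolding metrizable_uspaces_def by blast
qed

lemma fst_realization [simp]: "fst (realization P) = realization_set P"
  by (simp add: realization_def metric_uspace_def)

lemma fst_metric_uspace [simp]: "fst (metric_uspace X d) = X"
  by (simp add: metric_uspace_def)

text \<open>The smaller of two radii serves for both, so the infimum runs over a filter base and a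
  single radius is enough.\<close>

lemma eventually_metric_uspace:
  "eventually Q (snd (metric_uspace X d)) \<longleftrightarrow>
    (\<exists>\<delta>>0. \<forall>x\<in>X. \<forall>y\<in>X. d x y < \<delta> \<longrightarrow> Q (x, y))"
proof -
  have "eventually Q (snd (metric_uspace X d)) \<longleftrightarrow>
    (\<exists>\<delta>\<in>{0<..}. eventually Q (principal {(x, y). x \<in> X \<and> y \<in> X \<and> d x y < \<delta>}))"
    unfolding metric_uspace_def snd_conv
  proof (rule eventually_INF_base)
    fix a b :: real assume "a \<in> {0<..}" "b \<in> {0<..}"
    then show "\<exists>e\<in>{0<..}. principal {(x, y). x \<in> X \<and> y \<in> X \<and> d x y < e}
        \<le> inf (principal {(x, y). x \<in> X \<and> y \<in> X \<and> d x y < a})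
              (principal {(x, y). x \<in> X \<and> y \<in> X \<and> d x y < b})"
      by (intro bexI[of _ "min a b"]) auto
  qed auto
  then show ?thesis by (auto simp: eventually_principal)
qed

lemma uniform_maps_metric:
  "f \<in> uniform_maps (metric_uspace X d) (metric_uspace Y e) \<longleftrightarrow>
    f \<in> X \<rightarrow>\<^sub>E Y \<and> (\<forall>\<epsilon>>0. \<exists>\<delta>>0. \<forall>x\<in>X. \<forall>y\<in>X. d x y < \<delta> \<longrightarrow> e (f x) (f y) < \<epsilon>)"
proof -
  have "filterlim (\<lambda>(x, y). (f x, f y)) (snd (metric_uspace Y e)) (snd (metric_uspace X d)) \<longleftrightarrow>
     (\<forall>\<epsilon>>0. \<exists>\<delta>>0. \<forall>x\<in>X. \<forall>y\<in>X. d x y < \<delta> \<longrightarrow> f x \<in> Y \<and> f y \<in> Y \<and> e (f x) (f y) < \<epsilon>)"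
    by (simp add: metric_uspace_def[of Y e] filterlim_INF filterlim_principal eventually_metric_uspace
        Ball_def)
  then show ?thesis by (auto simp: uniform_maps_def PiE_iff)
qed

section \<open>Metric properties of realized maps\<close>

text \<open>A nonzero value of \<open>|f| x\<close> at \<open>s\<close> equals \<open>x p\<close>
  for some \<open>p\<close> with \<open>s <= f p\<close>, while \<open>y p\<close> is at most the
  value of \<open>|f| y\<close> at \<open>s\<close>. Exchanging \<open>x\<close> and
  \<open>y\<close> gives the other inequality.\<close>

lemma realization_map_dist_le:
  assumes "P \<in> posets" "Q \<in> posets" "f \<in> monotone_maps P Q"
    and x: "x \<in> realization_set P" and y: "y \<in> realization_set P"
  shows "sup_dist Q (realization_map P Q f x) (realization_map P Q f y) \<le> sup_dist P x y"
proof (rule sup_dist_le[OF realization_map_in[OF assms(1-4)]])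
  fix s
  have *: "realization_map P Q f x s \<le> realization_map P Q f y s + \<bar>d\<bar>"
    if x: "x \<in> realization_set P" and y: "y \<in> realization_set P"
      and d: "\<And>p. \<bar>x p - y p\<bar> \<le> d" for x y d
  proof (cases "realization_map P Q f x s = 0")
    case True
    then show ?thesis using realization_set_nonneg[OF realization_map_in[OF assms(1-3) y], of s] by simp
  next
    case False
    then obtain p where p: "p \<in> Field P" "(s, f p) \<in> Q" "realization_map P Q f x s = x p"
      using realization_map_attained[OF assms(1-3) x] by blast
    then have "y p \<le> realization_map P Q f y s" using realization_map_ge[OF assms(1-3) y] by blast
    then show ?thesis using p d[of p] by linarith
  qed
  have "0 \<le> sup_dist P x y" using sup_dist_ge[OF x y, of undefined] by linarith
  then show "\<bar>realization_map P Q f x s - realization_map P Q f y s\<bar> \<le> sup_dist P x y"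
    using *[OF x y sup_dist_ge[OF x y]] *[OF y x, of "sup_dist P x y"] sup_dist_ge[OF x y]
    by (simp add: abs_minus_commute abs_le_iff)
qed

lemma realization_map_uniform:
  assumes "P \<in> posets" "Q \<in> posets" "f \<in> monotone_maps P Q"
  shows "realization_map P Q f \<in> uniform_maps (realization P) (realization Q)"
  unfolding realization_def uniform_maps_metric
proof (intro conjI allI impI)
  show "realization_map P Q f \<in> realization_set P \<rightarrow>\<^sub>E realization_set Q"
    using realization_map_in[OF assms] by (auto simp: realization_map_eq[OF assms])
  show "\<exists>\<delta>>0. \<forall>x\<in>realization_set P. \<forall>y\<in>realization_set P. sup_dist P x y < \<delta> \<longrightarrow>
      sup_dist Q (realization_map P Q f x) (realization_map P Q f y) < \<epsilon>" if "\<epsilon> > 0" for \<epsilon>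
    using realization_map_dist_le[OF assms] that by (meson order_le_less_trans)
qed

text \<open>The least chain element whose image lies above \<open>f m\<close> has the same image as
  \<open>m\<close>, so by injectivity it is \<open>m\<close>. Thus the coordinates of
  \<open>x\<close> on the chain can be recovered from its image.\<close>

lemma inj_on_chain_realization_map_apply:
  assumes "P \<in> posets" "Q \<in> posets" "f \<in> monotone_maps P Q" "C \<in> finite_chains P"
    and inj: "inj_on f C" and x: "x \<in> convex hull (vertex P ` C)" and m: "m \<in> C"
  shows "realization_map P Q f x (f m) = x m"
  unfolding realization_map_apply[OF assms(1-3) hull_subset_realization_set[OF assms(4) x]]
proof (rule extension_cases[OF assms(1-4), of "f m"])
  fix n
  assume eval: "n \<in> C" "(f m, f n) \<in> Q" "\<And>r. r \<in> C \<Longrightarrow> (f m, f r) \<in> Q \<Longrightarrow> (n, r) \<in> P"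
    "\<And>x. x \<in> convex hull (vertex P ` C) \<Longrightarrow> extension P Q f x (f m) = x n"
  have "(f m, f m) \<in> Q"
    using poset_refl[OF assms(2)] monotone_maps_Field[OF assms(3)] finite_chains_Field[OF assms(4) m]
    by blast
  then have "(n, m) \<in> P" using eval(3) m by blast
  then have "(f n, f m) \<in> Q" by (rule monotone_mapsD[OF assms(3)])
  then have "f n = f m" using eval(2) by (rule poset_antisym[OF assms(2)])
  then have "n = m" using inj eval(1) m by (simp add: inj_on_eq_iff)
  then show "extension P Q f x (f m) = x m" using eval(4) x by simp
next
  assume "\<And>r. r \<in> C \<Longrightarrow> (f m, f r) \<notin> Q"
  then show "extension P Q f x (f m) = x m"
    using poset_refl[OF assms(2)] monotone_maps_Field[OF assms(3)] finite_chains_Field[OF assms(4) m] m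
    by blast
qed

text \<open>Each coordinate of \<open>x\<close> and \<open>y\<close> is their coordinate at a common
  chain element or 0 for both, and chain coordinates survive in the image. Together with
  \<open>realization_map_dist_le\<close> the map is an isometry on this simplex.\<close>

lemma inj_on_chain_dist_le:
  assumes "P \<in> posets" "Q \<in> posets" "f \<in> monotone_maps P Q" "C \<in> finite_chains P"
    and inj: "inj_on f C"
    and x: "x \<in> convex hull (vertex P ` C)" and y: "y \<in> convex hull (vertex P ` C)"
  shows "sup_dist P x y \<le> sup_dist Q (realization_map P Q f x) (realization_map P Q f y)"
proof -
  note x' = hull_subset_realization_set[OF assms(4) x] and y' = hull_subset_realization_set[OF assms(4) y]
  note ge = sup_dist_ge[OF realization_map_in[OF assms(1-3) x'] realization_map_in[OF assms(1-3) y']]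
  show ?thesis
  proof (rule sup_dist_le[OF x'])
    fix s
    show "\<bar>x s - y s\<bar> \<le> sup_dist Q (realization_map P Q f x) (realization_map P Q f y)"
    proof (cases "\<exists>r\<in>C. (s, r) \<in> P")
      case True
      then obtain m where "m \<in> C" "x s = x m" "y s = y m"
        using hull_eq_eval[OF assms(1,4)] x y by metis
      then show ?thesis
        using ge[of "f m"] inj_on_chain_realization_map_apply[OF assms(1-5)] x y by simp
    next
      case False
      then have "x s = 0" "y s = 0" using hull_eq_0 x y by metis+
      then show ?thesis using ge[of undefined] by simp
    qed
  qed
qed

lemma inj_on_chain_realization_map_inj:
  assumes "P \<in> posets" "Q \<in> posets" "f \<in> monotone_maps P Q" "C \<in> finite_chains P" "inj_on f C"
  shows "inj_on (realization_map P Q f) (convex hull (vertex P ` C))"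
proof (intro inj_onI ext)
  fix x y s
  assume xy: "x \<in> convex hull (vertex P ` C)" "y \<in> convex hull (vertex P ` C)"
    and eq: "realization_map P Q f x = realization_map P Q f y"
  show "x s = y s"
  proof (cases "\<exists>r\<in>C. (s, r) \<in> P")
    case True
    then obtain m where "m \<in> C" "x s = x m" "y s = y m"
      using hull_eq_eval[OF assms(1,4)] xy by metis
    then show ?thesis
      using inj_on_chain_realization_map_apply[OF assms] xy eq by metis
  next
    case False
    then show ?thesis using hull_eq_0 xy by metis
  qed
qed

section \<open>Pullbacks\<close>

text \<open>The test object for both universal properties: for distinct \<open>u\<close> and
  \<open>v\<close>, monotone maps out of it are comparable pairs, and monotone maps into it are
  upsets.\<close>

definition two_chain :: "'u \<Rightarrow> 'u \<Rightarrow> 'u rel"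
  where "two_chain u v = {(u, u), (u, v), (v, v)}"

lemma Field_two_chain [simp]: "Field (two_chain u v) = {u, v}"
  by (auto simp: two_chain_def Field_def)

lemma two_chain_countable_poset: "u \<noteq> v \<Longrightarrow> two_chain u v \<in> countable_posets"
  by (auto simp: countable_posets_def posets_def partial_order_on_def preorder_on_def refl_on_def
      trans_def antisym_def two_chain_def Field_def)

lemma two_chain_monotone_map:
  assumes "(a, a) \<in> A" "(a, a') \<in> A" "(a', a') \<in> A" "u \<noteq> v"
  shows "(\<lambda>x\<in>{u, v}. if x = u then a else a') \<in> monotone_maps (two_chain u v) A"
  using assms by (intro monotone_mapsI) (auto simp: two_chain_def Field_def)

lemma poset_pullback_universal:
  assumes "poset_pullback \<Z> P A B C p q f g" "Z \<in> \<Z>" "a \<in> monotone_maps Z A" "b \<in> monotone_maps Z B"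
    and "compose (Field Z) f a = compose (Field Z) g b"
  shows "\<exists>!h. h \<in> monotone_maps Z P \<and> compose (Field Z) p h = a \<and> compose (Field Z) q h = b"
  using assms by (simp add: poset_pullback_def)

text \<open>Elements correspond to constant maps out of the two-element chain, so the universal
  property applies to the pair of constants \<open>a\<close> and \<open>b\<close>.\<close>

lemma poset_pullback_ex1:
  assumes pb: "poset_pullback \<Z> P A B C p q f g" and Z: "two_chain u v \<in> \<Z>" "u \<noteq> v"
    and P: "P \<in> posets" and A: "A \<in> posets" and B: "B \<in> posets"
    and a: "a \<in> Field A" and b: "b \<in> Field B" and eq: "f a = g b"
  shows "\<exists>!r. r \<in> Field P \<and> p r = a \<and> q r = b"
proof -
  \<comment> \<open>The constant map is written with a vacuous case distinction to fit
    \<open>two_chain_monotone_map\<close>.\<close>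
  let ?Z = "two_chain u v" and ?c = "\<lambda>r. \<lambda>x\<in>{u, v}. if x = u then r else r"
  have const: "?c r \<in> monotone_maps ?Z R" if "R \<in> posets" "r \<in> Field R" for r and R :: "'x rel"
    using that Z by (intro two_chain_monotone_map) (auto intro: poset_refl)
  have "compose (Field ?Z) f (?c a) = compose (Field ?Z) g (?c b)"
    using eq by (auto simp: compose_def)
  then have ex1: "\<exists>!h. h \<in> monotone_maps ?Z P \<and> compose (Field ?Z) p h = ?c a \<and>
      compose (Field ?Z) q h = ?c b"
    using const[OF A a] const[OF B b] by (intro poset_pullback_universal[OF pb Z(1)]) auto
  then obtain h where h: "h \<in> monotone_maps ?Z P" "compose (Field ?Z) p h = ?c a"
      "compose (Field ?Z) q h = ?c b" by blast
  show ?thesis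
  proof (rule ex1I[of _ "h u"])
    show "h u \<in> Field P \<and> p (h u) = a \<and> q (h u) = b"
      using monotone_maps_Field[OF h(1), of u] fun_cong[OF h(2), of u] fun_cong[OF h(3), of u]
      by (simp add: compose_def)
    fix r assume r: "r \<in> Field P \<and> p r = a \<and> q r = b"
    then have "compose (Field ?Z) p (?c r) = ?c a" "compose (Field ?Z) q (?c r) = ?c b"
      by (auto simp: compose_def)
    then have "?c r = h" using ex1 h const[OF P] r by blast
    then have "?c r u = h u" by (rule fun_cong)
    then show "r = h u" by simp
  qed
qed

text \<open>The two comparable pairs are maps out of the two-element chain. Their common lift
  \<open>h\<close> sends \<open>u\<close> to \<open>r\<close> and \<open>v\<close> to
  \<open>r'\<close> by uniqueness of lifted elements, and \<open>h\<close> is monotone.\<close>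

lemma poset_pullback_order:
  assumes pb: "poset_pullback \<Z> P A B C p q f g" and Z: "two_chain u v \<in> \<Z>" "u \<noteq> v"
    and P: "P \<in> posets" and A: "A \<in> posets" and B: "B \<in> posets"
    and r: "r \<in> Field P" "r' \<in> Field P" and le: "(p r, p r') \<in> A" "(q r, q r') \<in> B"
  shows "(r, r') \<in> P"
proof -
  let ?Z = "two_chain u v"
  let ?a = "\<lambda>x\<in>{u, v}. if x = u then p r else p r'"
  let ?b = "\<lambda>x\<in>{u, v}. if x = u then q r else q r'"
  have pq: "p \<in> monotone_maps P A" "q \<in> monotone_maps P B"
    and comm: "compose (Field P) f p = compose (Field P) g q"
    using pb by (simp_all add: poset_pullback_def)
  have F: "p s \<in> Field A" "q s \<in> Field B" "f (p s) = g (q s)" if "s \<in> Field P" for s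
    using that pq fun_cong[OF comm, of s] by (simp_all add: monotone_maps_Field compose_eq)
  have ab: "?a \<in> monotone_maps ?Z A" "?b \<in> monotone_maps ?Z B"
    using le r F Z A B by (auto intro!: two_chain_monotone_map poset_refl)
  have "compose (Field ?Z) f ?a = compose (Field ?Z) g ?b"
    using r F by (auto simp: compose_def)
  then have "\<exists>!h. h \<in> monotone_maps ?Z P \<and> compose (Field ?Z) p h = ?a \<and> compose (Field ?Z) q h = ?b"
    using poset_pullback_universal[OF pb Z(1) ab] by blast
  then obtain h where h: "h \<in> monotone_maps ?Z P" "compose (Field ?Z) p h = ?a"
      "compose (Field ?Z) q h = ?b" by blast
  have hF: "h u \<in> Field P" "h v \<in> Field P" using monotone_maps_Field[OF h(1)] by auto
  have hu: "p (h u) = p r" "q (h u) = q r"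
    using fun_cong[OF h(2), of u] fun_cong[OF h(3), of u] by (simp_all add: compose_def)
  have hv: "p (h v) = p r'" "q (h v) = q r'"
    using fun_cong[OF h(2), of v] fun_cong[OF h(3), of v] Z by (simp_all add: compose_def)
  have "h u = r"
    using poset_pullback_ex1[OF pb Z P A B F(1,2,3)[OF r(1)]] hF hu r by blast
  moreover have "h v = r'"
    using poset_pullback_ex1[OF pb Z P A B F(1,2,3)[OF r(2)]] hF hv r by blast
  ultimately show ?thesis
    using monotone_mapsD[OF h(1), of u v] by (simp add: two_chain_def)
qed

section \<open>The point of the realized pullback over a compatible pair\<close>

text \<open>The minimum intersects superlevel sets: those of the new point are the common preimages
  under \<open>p\<close> and \<open>q\<close> of those of \<open>x\<close> and
  \<open>y\<close>.\<close>

definition pullback_point :: "'p rel \<Rightarrow> ('p \<Rightarrow> 'a) \<Rightarrow> ('p \<Rightarrow> 'b) \<Rightarrow> ('a \<Rightarrow> real) \<Rightarrow> ('b \<Rightarrow> real) \<Rightarrow> 'p \<Rightarrow> real"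
  where "pullback_point P p q x y s = (if s \<in> Field P then min (x (p s)) (y (q s)) else 0)"

text \<open>The pullback property enters only through elements and order, as \<open>lift\<close> and
  \<open>order\<close>, so the type of the test posets disappears.\<close>

locale realization_pullback =
  fixes P :: "'p rel" and A :: "'a rel" and B :: "'b rel" and C :: "'c rel" and p q f g
  assumes posets: "P \<in> posets" "A \<in> posets" "B \<in> posets" "C \<in> posets"
    and maps: "p \<in> monotone_maps P A" "q \<in> monotone_maps P B"
      "f \<in> monotone_maps A C" "g \<in> monotone_maps B C"
    and comm: "compose (Field P) f p = compose (Field P) g q"
    and lift: "\<And>a b. \<lbrakk>a \<in> Field A; b \<in> Field B; f a = g b\<rbrakk> \<Longrightarrow> \<exists>r\<in>Field P. p r = a \<and> q r = b"
    and order: "\<And>r r'. \<lbrakk>r \<in> Field P; r' \<in> Field P; (p r, p r') \<in> A; (q r, q r') \<in> B\<rbrakk> \<Longrightarrow> (r, r') \<in> P"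
begin

abbreviation "p' \<equiv> realization_map P A p"
abbreviation "q' \<equiv> realization_map P B q"
abbreviation "f' \<equiv> realization_map A C f"
abbreviation "g' \<equiv> realization_map B C g"

lemmas map_p = posets(1,2) maps(1)
lemmas map_q = posets(1,3) maps(2)
lemmas map_f = posets(2,4) maps(3)
lemmas map_g = posets(3,4) maps(4)

text \<open>The level elements of \<open>x\<close> and \<open>y\<close> at height \<open>c\<close>
  have the same image in \<open>C\<close>, because level elements of the common image point are
  unique. They therefore lift to some \<open>r\<close>, whose ideal is cut out by the ideals of
  \<open>p r\<close> and \<open>q r\<close>.\<close>

lemma pullback_point_level:
  assumes x: "x \<in> realization_set A" and y: "y \<in> realization_set B" and eq: "f' x = g' y"
    and c: "0 < c" "c \<le> 1"
  obtains r where "level P (pullback_point P p q x y) c r" "level A x c (p r)" "level B y c (q r)"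
proof -
  obtain a b where ab: "level A x c a" "level B y c b"
    using realization_set_level[OF posets(2) x c] realization_set_level[OF posets(3) y c] by metis
  have "f a = g b"
    using realization_map_level[OF map_f x ab(1) c(1)] realization_map_level[OF map_g y ab(2) c(1)] eq
    by (auto intro: level_unique[OF posets(4)])
  then obtain r where r: "r \<in> Field P" "p r = a" "q r = b"
    using lift level_Field[OF ab(1)] level_Field[OF ab(2)] by blast
  have "level P (pullback_point P p q x y) c r"
    unfolding level_def
  proof (intro conjI ballI)
    fix s assume s: "s \<in> Field P"
    have "c \<le> pullback_point P p q x y s \<longleftrightarrow> (p s, p r) \<in> A \<and> (q s, q r) \<in> B"
      using s r levelD[OF ab(1)] levelD[OF ab(2)] monotone_maps_Field[OF maps(1)]
        monotone_maps_Field[OF maps(2)] by (simp add: pullback_point_def)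
    also have "\<dots> \<longleftrightarrow> (s, r) \<in> P"
      using order[OF s r(1)] monotone_mapsD[OF maps(1)] monotone_mapsD[OF maps(2)] by blast
    finally show "c \<le> pullback_point P p q x y s \<longleftrightarrow> (s, r) \<in> P" .
  qed (rule r(1))
  then show thesis using that ab r by blast
qed

lemma pullback_point_in:
  assumes x: "x \<in> realization_set A" and y: "y \<in> realization_set B" and eq: "f' x = g' y"
  shows "pullback_point P p q x y \<in> realization_set P"
proof (rule realization_setI[OF posets(1)])
  show "0 \<le> pullback_point P p q x y s" for s
    using realization_set_nonneg[OF x] realization_set_nonneg[OF y] by (simp add: pullback_point_def)
  show "pullback_point P p q x y s \<le> 1" for s
    using realization_set_le_1[OF x, of "p s"] by (simp add: pullback_point_def min.coboundedI1)
  have "range (pullback_point P p q x y) \<subseteq> insert 0 (range x \<union> range y)"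
    by (auto simp: pullback_point_def min_def)
  then show "finite (range (pullback_point P p q x y))"
    using realization_set_finite_range[OF posets(2) x] realization_set_finite_range[OF posets(3) y]
    by (auto intro: finite_subset)
  show "\<exists>r. level P (pullback_point P p q x y) c r" if "0 < c" "c \<le> 1" for c
    using pullback_point_level[OF assms that] by metis
qed (simp add: pullback_point_def)

lemma pullback_point_proj:
  assumes x: "x \<in> realization_set A" and y: "y \<in> realization_set B" and eq: "f' x = g' y"
  shows "p' (pullback_point P p q x y) = x" "q' (pullback_point P p q x y) = y"
proof -
  note w = pullback_point_in[OF assms]
  show "p' (pullback_point P p q x y) = x"
    by (rule realization_set_eqI[OF posets(2) realization_map_in[OF map_p w] x])
      (use realization_map_level[OF map_p w] pullback_point_level[OF assms] in metis)
  show "q' (pullback_point P p q x y) = y"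
    by (rule realization_set_eqI[OF posets(3) realization_map_in[OF map_q w] y])
      (use realization_map_level[OF map_q w] pullback_point_level[OF assms] in metis)
qed

text \<open>Level elements of \<open>w\<close> and \<open>w'\<close> at the same height have equal
  images under \<open>p\<close> and under \<open>q\<close>. Since \<open>p\<close> and
  \<open>q\<close> jointly reflect the order, antisymmetry makes them equal.\<close>

lemma pullback_point_unique:
  assumes w: "w \<in> realization_set P" and w': "w' \<in> realization_set P"
    and eq: "p' w = p' w'" "q' w = q' w'"
  shows "w = w'"
proof (rule realization_set_eqI[OF posets(1) w w'])
  fix c :: real assume c: "0 < c" "c \<le> 1"
  obtain r r' where r: "level P w c r" and r': "level P w' c r'"
    using realization_set_level[OF posets(1) w c] realization_set_level[OF posets(1) w' c] by metis
  have "p r = p r'"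
    using realization_map_level[OF map_p w r c(1)] realization_map_level[OF map_p w' r' c(1)] eq
    by (auto intro: level_unique[OF posets(2)])
  moreover have "q r = q r'"
    using realization_map_level[OF map_q w r c(1)] realization_map_level[OF map_q w' r' c(1)] eq
    by (auto intro: level_unique[OF posets(3)])
  moreover note level_Field[OF r] level_Field[OF r']
  ultimately have "(r, r') \<in> P" "(r', r) \<in> P"
    using order[of r r'] order[of r' r] poset_refl[OF posets(2) monotone_maps_Field[OF maps(1)]]
      poset_refl[OF posets(3) monotone_maps_Field[OF maps(2)]] by metis+
  then have "r = r'" by (rule poset_antisym[OF posets(1)])
  then show "\<exists>r. level P w c r \<and> level P w' c r" using r r' by blast
qed

lemma pullback_point_dist:
  assumes x: "x \<in> realization_set A" "x' \<in> realization_set A"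
    and y: "y \<in> realization_set B" "y' \<in> realization_set B" and eq: "f' x = g' y"
  shows "sup_dist P (pullback_point P p q x y) (pullback_point P p q x' y')
    \<le> max (sup_dist A x x') (sup_dist B y y')"
proof (rule sup_dist_le[OF pullback_point_in[OF x(1) y(1) eq]])
  fix s assume "s \<in> Field P"
  then show "\<bar>pullback_point P p q x y s - pullback_point P p q x' y' s\<bar>
      \<le> max (sup_dist A x x') (sup_dist B y y')"
    using sup_dist_ge[OF x, of "p s"] sup_dist_ge[OF y, of "q s"]
    by (simp add: pullback_point_def min_def max_def abs_le_iff)
qed

lemma uspace_pullback_realization:
  "uspace_pullback metrizable_uspaces (realization P) (realization A) (realization B) (realization C) p' q' f' g'"
  unfolding uspace_pullback_def
proof (intro conjI ballI impI)
  show "p' \<in> uniform_maps (realization P) (realization A)" by (rule realization_map_uniform[OF map_p])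
  show "q' \<in> uniform_maps (realization P) (realization B)" by (rule realization_map_uniform[OF map_q])
  show "f' \<in> uniform_maps (realization A) (realization C)" by (rule realization_map_uniform[OF map_f])
  show "g' \<in> uniform_maps (realization B) (realization C)" by (rule realization_map_uniform[OF map_g])
  show "compose (fst (realization P)) f' p' = compose (fst (realization P)) g' q'"
    using realization_map_compose[OF posets(1,2,4) maps(1,3)]
      realization_map_compose[OF posets(1,3,4) maps(2,4)] comm by simp
next
  fix Z :: "'z uspace" and \<alpha> \<beta>
  assume "Z \<in> metrizable_uspaces"
    and \<alpha>: "\<alpha> \<in> uniform_maps Z (realization A)" and \<beta>: "\<beta> \<in> uniform_maps Z (realization B)"
    and eq: "compose (fst Z) f' \<alpha> = compose (fst Z) g' \<beta>"
  then obtain X d where Z: "Z = metric_uspace X d" by (auto simp: metrizable_uspaces_def)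
  note \<alpha> = \<alpha>[unfolded Z realization_def uniform_maps_metric]
  note \<beta> = \<beta>[unfolded Z realization_def uniform_maps_metric]
  have \<alpha>X: "\<alpha> t \<in> realization_set A" and \<beta>X: "\<beta> t \<in> realization_set B"
    and fg: "f' (\<alpha> t) = g' (\<beta> t)" if "t \<in> X" for t
    using \<alpha> \<beta> that fun_cong[OF eq, of t] by (auto simp: Z compose_eq)
  let ?u = "\<lambda>t\<in>X. pullback_point P p q (\<alpha> t) (\<beta> t)"
  note w = pullback_point_in[OF \<alpha>X \<beta>X fg]
  show "\<exists>!u. u \<in> uniform_maps Z (realization P) \<and> compose (fst Z) p' u = \<alpha> \<and> compose (fst Z) q' u = \<beta>"
  proof (rule ex1I[of _ ?u], intro conjI)
    show "?u \<in> uniform_maps Z (realization P)"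
      unfolding Z realization_def uniform_maps_metric
    proof (intro conjI allI impI)
      show "?u \<in> X \<rightarrow>\<^sub>E realization_set P" using w by auto
      fix \<epsilon> :: real assume "0 < \<epsilon>"
      obtain \<delta>1 where \<delta>1: "0 < \<delta>1" "\<forall>x\<in>X. \<forall>y\<in>X. d x y < \<delta>1 \<longrightarrow> sup_dist A (\<alpha> x) (\<alpha> y) < \<epsilon>"
        using \<alpha> \<open>0 < \<epsilon>\<close> by blast
      obtain \<delta>2 where \<delta>2: "0 < \<delta>2" "\<forall>x\<in>X. \<forall>y\<in>X. d x y < \<delta>2 \<longrightarrow> sup_dist B (\<beta> x) (\<beta> y) < \<epsilon>"
        using \<beta> \<open>0 < \<epsilon>\<close> by blast
      show "\<exists>\<delta>>0. \<forall>x\<in>X. \<forall>y\<in>X. d x y < \<delta> \<longrightarrow> sup_dist P (?u x) (?u y) < \<epsilon>"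
      proof (intro exI[of _ "min \<delta>1 \<delta>2"] conjI ballI impI)
        fix x y assume xy: "x \<in> X" "y \<in> X" "d x y < min \<delta>1 \<delta>2"
        then have "max (sup_dist A (\<alpha> x) (\<alpha> y)) (sup_dist B (\<beta> x) (\<beta> y)) < \<epsilon>"
          using \<delta>1 \<delta>2 by simp
        from le_less_trans[OF pullback_point_dist[OF \<alpha>X[OF xy(1)] \<alpha>X[OF xy(2)] \<beta>X[OF xy(1)]
              \<beta>X[OF xy(2)] fg[OF xy(1)]] this]
        show "sup_dist P (?u x) (?u y) < \<epsilon>" using xy by simp
      qed (use \<delta>1 \<delta>2 in simp)
    qed
    show "compose (fst Z) p' ?u = \<alpha>"
      using \<alpha> pullback_point_proj(1)[OF \<alpha>X \<beta>X fg]
      by (intro extensionalityI[of _ X]) (auto simp: Z compose_eq compose_extensional PiE_def)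
    show "compose (fst Z) q' ?u = \<beta>"
      using \<beta> pullback_point_proj(2)[OF \<alpha>X \<beta>X fg]
      by (intro extensionalityI[of _ X]) (auto simp: Z compose_eq compose_extensional PiE_def)
    fix u assume u: "u \<in> uniform_maps Z (realization P) \<and> compose (fst Z) p' u = \<alpha> \<and> compose (fst Z) q' u = \<beta>"
    then have uX: "u \<in> X \<rightarrow>\<^sub>E realization_set P" by (simp add: Z realization_def uniform_maps_metric)
    show "u = ?u"
    proof (rule extensionalityI[of _ X])
      fix t assume t: "t \<in> X"
      have "p' (u t) = \<alpha> t" "q' (u t) = \<beta> t"
        using u t by (auto simp: Z compose_eq)
      then have "u t = pullback_point P p q (\<alpha> t) (\<beta> t)"
        using uX t by (intro pullback_point_unique w)
          (auto simp: pullback_point_proj[OF \<alpha>X \<beta>X fg])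
      then show "u t = ?u t" using t by simp
    qed (use uX in \<open>auto simp: PiE_def\<close>)
  qed
qed

end

lemma realization_preserves_pullback:
  assumes posets: "P \<in> posets" "A \<in> posets" "B \<in> posets" "C \<in> posets"
    and pb: "poset_pullback \<Z> P A B C p q f g" and Z: "two_chain u v \<in> \<Z>" "u \<noteq> v"
  shows "uspace_pullback metrizable_uspaces (realization P) (realization A) (realization B)
    (realization C) (realization_map P A p) (realization_map P B q)
    (realization_map A C f) (realization_map B C g)"
proof -
  interpret realization_pullback P A B C p q f g
  proof
    show "\<exists>r\<in>Field P. p r = a \<and> q r = b" if "a \<in> Field A" "b \<in> Field B" "f a = g b" for a b
      using poset_pullback_ex1[OF pb Z posets(1-3) that] by blast
    show "(r, r') \<in> P" if "r \<in> Field P" "r' \<in> Field P" "(p r, p r') \<in> A" "(q r, q r') \<in> B" for r r'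
      using poset_pullback_order[OF pb Z posets(1-3) that] .
  qed (use pb posets in \<open>simp_all add: poset_pullback_def\<close>)
  show ?thesis by (rule uspace_pullback_realization)
qed

section \<open>Nearby points in a common simplex\<close>

text \<open>Rounds the values to multiples of \<open>1 / N\<close>: down for
  \<open>\<theta> = 0\<close>, to a nearest multiple for \<open>\<theta> = 1/2\<close>.\<close>

definition disc :: "nat \<Rightarrow> real \<Rightarrow> ('a \<Rightarrow> real) \<Rightarrow> 'a \<Rightarrow> real"
  where "disc N \<theta> x s = \<lfloor>real N * x s + \<theta>\<rfloor> / real N"

lemma disc_dist:
  assumes "0 < N" "0 \<le> \<theta>" "\<theta> < 1"
  shows "\<bar>x s - disc N \<theta> x s\<bar> \<le> 1 / real N"
proof -
  have "x s - disc N \<theta> x s = (real N * x s - \<lfloor>real N * x s + \<theta>\<rfloor>) / real N"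
    using assms by (simp add: disc_def field_simps)
  moreover have "\<bar>real N * x s - \<lfloor>real N * x s + \<theta>\<rfloor>\<bar> \<le> 1"
    using assms by linarith
  ultimately show ?thesis using assms by (simp add: divide_right_mono)
qed

lemma disc_ge_iff:
  assumes "0 < N"
  shows "c \<le> disc N \<theta> x s \<longleftrightarrow> (real_of_int \<lceil>real N * c\<rceil> - \<theta>) / real N \<le> x s"
proof -
  have "c \<le> disc N \<theta> x s \<longleftrightarrow> real N * c \<le> \<lfloor>real N * x s + \<theta>\<rfloor>"
    using assms by (simp add: disc_def pos_le_divide_eq mult.commute)
  also have "\<dots> \<longleftrightarrow> real_of_int \<lceil>real N * c\<rceil> \<le> real N * x s + \<theta>"
    by (simp add: ceiling_le_iff[symmetric] le_floor_iff)
  also have "\<dots> \<longleftrightarrow> (real_of_int \<lceil>real N * c\<rceil> - \<theta>) / real N \<le> x s"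
    using assms by (simp add: pos_divide_le_eq mult.commute diff_le_eq)
  finally show ?thesis .
qed

text \<open>By \<open>disc_ge_iff\<close> the superlevel set of the rounded point at
  \<open>c\<close> is that of \<open>x\<close> at \<open>(k - \<theta>) / N\<close> with
  \<open>k = \<lceil>N c\<rceil>\<close>. For \<open>c\<close> in (0,1] only \<open>k\<close> from 1
  to \<open>N\<close> occur, so these \<open>N\<close> heights decide which simplex contains the
  rounded point.\<close>

lemma disc_in_hull:
  assumes P: "P \<in> posets" and x: "x \<in> realization_set P"
    and N: "0 < N" and \<theta>: "0 \<le> \<theta>" "\<theta> < 1"
    and lev: "\<And>k. k \<in> {1..N} \<Longrightarrow> \<exists>p\<in>K. level P x ((real k - \<theta>) / real N) p"
  shows "disc N \<theta> x \<in> convex hull (vertex P ` K)"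
proof (rule hull_of_levels[OF P])
  have "range (disc N \<theta> x) \<subseteq> (\<lambda>v. \<lfloor>real N * v + \<theta>\<rfloor> / real N) ` range x"
    by (auto simp: disc_def)
  then show "finite (range (disc N \<theta> x))"
    using realization_set_finite_range[OF P x] finite_surj by metis
  show "0 \<le> disc N \<theta> x s" for s
    using realization_set_nonneg[OF x, of s] \<theta> by (simp add: disc_def)
  show "disc N \<theta> x s \<le> 1" for s
  proof -
    have "real N * x s \<le> real N * 1"
      using realization_set_le_1[OF x, of s] by (intro mult_left_mono) auto
    then have "\<lfloor>real N * x s + \<theta>\<rfloor> \<le> int N" using \<theta> by (simp add: floor_le_iff)
    then show ?thesis using N by (simp add: disc_def)
  qed
  show "disc N \<theta> x s = 0" if "s \<notin> Field P" for s
    using realization_set_outside[OF x that] \<theta> by (simp add: disc_def floor_eq_iff)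
  fix c :: real assume c: "0 < c" "c \<le> 1"
  define k where "k = nat \<lceil>real N * c\<rceil>"
  have pos: "0 < real N * c" using N c by simp
  have "real N * c \<le> real N * 1" using c by (intro mult_left_mono) auto
  then have "\<lceil>real N * c\<rceil> \<le> int N" by (simp add: ceiling_le_iff)
  moreover have "1 \<le> \<lceil>real N * c\<rceil>" using pos by linarith
  ultimately have k: "k \<in> {1..N}" "real_of_int \<lceil>real N * c\<rceil> = real k"
    unfolding k_def by (simp_all add: nat_le_iff le_nat_iff del: ceiling_le_iff)
  then show "\<exists>p\<in>K. level P (disc N \<theta> x) c p"
    using lev[OF k(1)] disc_ge_iff[OF N, of c \<theta> x] by (simp add: level_def)
qed

lemma level_in_supp: "level P x c p \<Longrightarrow> 0 < c \<Longrightarrow> c \<le> 1 \<Longrightarrow> p \<in> supp P x"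
  unfolding supp_def by (intro CollectI bexI[of _ c]) auto

text \<open>The level elements of \<open>x\<close> at the heights \<open>k / N\<close> interlace with those of \<open>y\<close> at the heights
  \<open>(k - 1/2) / N\<close>, so together they form a chain.\<close>

lemma disc_common_chain:
  assumes P: "P \<in> posets" and x: "x \<in> realization_set P" and y: "y \<in> realization_set P"
    and N: "0 < N" and close: "\<And>s. \<bar>x s - y s\<bar> \<le> 1 / (2 * real N)"
  obtains C where "C \<in> finite_chains P" "disc N 0 x \<in> convex hull (vertex P ` C)"
    "disc N (1/2) y \<in> convex hull (vertex P ` C)"
proof -
  define K where "K = {p. \<exists>k\<in>{1..N}. level P x (real k / real N) p}"
  define L where "L = {p. \<exists>k\<in>{1..N}. level P y ((real k - 1/2) / real N) p}"
  have K_supp: "K \<subseteq> supp P x" using N by (auto simp: K_def intro!: level_in_supp)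
  have L_supp: "L \<subseteq> supp P y" using N by (auto simp: L_def intro!: level_in_supp)
  note sx = realization_set_supp[OF P x] and sy = realization_set_supp[OF P y]
  have levK: "\<exists>p\<in>K. level P x ((real k - 0) / real N) p" if k: "k \<in> {1..N}" for k
  proof -
    have "0 < real k / real N" "real k / real N \<le> 1" using k N by auto
    then obtain p where "level P x (real k / real N) p" by (rule realization_set_level[OF P x])
    then show ?thesis using k by (intro bexI[of _ p]) (auto simp: K_def)
  qed
  have levL: "\<exists>p\<in>L. level P y ((real k - 1/2) / real N) p" if k: "k \<in> {1..N}" for k
  proof -
    have "0 < (real k - 1/2) / real N" "(real k - 1/2) / real N \<le> 1"
      using k N by (simp_all add: divide_le_eq)
    then obtain p where "level P y ((real k - 1/2) / real N) p" by (rule realization_set_level[OF P y])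
    then show ?thesis using k unfolding L_def by blast
  qed
  \<comment> \<open>The tolerance is half a grid step. For \<open>l <= k\<close> the value
    \<open>y p\<close> still reaches the height of \<open>q\<close>, so \<open>p\<close> lies below
    \<open>q\<close>; for \<open>l >= k + 1\<close> the value \<open>x q\<close> reaches the height
    of \<open>p\<close>, so \<open>q\<close> lies below \<open>p\<close>.\<close>
  have cross: "(p, q) \<in> P \<or> (q, p) \<in> P" if p: "p \<in> K" and q: "q \<in> L" for p q
  proof -
    obtain k where k: "level P x (real k / real N) p" using p by (auto simp: K_def)
    obtain l where l: "level P y ((real l - 1/2) / real N) q" using q by (auto simp: L_def)
    show ?thesis
    proof (cases "l \<le> k")
      case True
      have "(real l - 1/2) / real N \<le> (real k - 1/2) / real N"
        using True by (intro divide_right_mono) auto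
      also have "\<dots> = real k / real N - 1 / (2 * real N)" by (simp add: diff_divide_distrib)
      also have "\<dots> \<le> y p" using level_self[OF P k] close[of p] by linarith
      finally show ?thesis using levelD[OF l level_Field[OF k]] by blast
    next
      case False
      have "real k / real N \<le> (real l - 1) / real N"
        using False by (intro divide_right_mono) auto
      also have "\<dots> = (real l - 1/2) / real N - 1 / (2 * real N)" 
        using N by (simp add: field_simps)
      also have "\<dots> \<le> x q" using level_self[OF P l] close[of q] by linarith
      finally show ?thesis using levelD[OF k level_Field[OF l]] by blast
    qed
  qed
  have "(p, q) \<in> P \<or> (q, p) \<in> P" if "p \<in> K \<union> L" "q \<in> K \<union> L" for p q
    using that cross finite_chains_total[OF sx] finite_chains_total[OF sy] K_supp L_supp by blast
  then have "K \<union> L \<in> Chains P" by (simp add: Chains_def)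
  moreover have "finite (K \<union> L)"
    using K_supp L_supp sx sy by (auto simp: finite_chains_def intro: finite_subset)
  moreover have "K \<union> L \<noteq> {}" using levK[of 1] N by auto
  ultimately have "K \<union> L \<in> finite_chains P" by (simp add: finite_chains_def)
  moreover have "disc N 0 x \<in> convex hull (vertex P ` (K \<union> L))"
    using levK by (intro disc_in_hull[OF P x N]) auto
  moreover have "disc N (1/2) y \<in> convex hull (vertex P ` (K \<union> L))"
    using levL by (intro disc_in_hull[OF P y N]) auto
  ultimately show thesis by (rule that)
qed

text \<open>Level elements of the rounded point are level elements of \<open>x\<close>, so rounding
  does not leave the simplex of the support.\<close>

lemma disc_in_hull_supp:
  assumes "P \<in> posets" "x \<in> realization_set P" "0 < N" "0 \<le> \<theta>" "\<theta> < 1"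
  shows "disc N \<theta> x \<in> convex hull (vertex P ` supp P x)"
proof (rule disc_in_hull[OF assms])
  fix k assume "k \<in> {1..N}"
  then have c: "0 < (real k - \<theta>) / real N" "(real k - \<theta>) / real N \<le> 1" using assms by auto
  then show "\<exists>p\<in>supp P x. level P x ((real k - \<theta>) / real N) p"
    using realization_set_level[OF assms(1,2) c] level_in_supp by metis
qed

text \<open>The path goes from \<open>x\<close> to its rounding, then to the rounding of
  \<open>y\<close>, then to \<open>y\<close>. The steps stay in the simplices of the support of
  \<open>x\<close>, of a common chain, and of the support of \<open>y\<close>.\<close>

lemma simplexwise_uniform_imp_uniform:
  assumes P: "P \<in> posets" and X: "Metric_space X d" and u: "u \<in> realization_set P \<rightarrow> X"
    and simplexwise: "\<And>\<epsilon>. 0 < \<epsilon> \<Longrightarrow> \<exists>\<delta>>0. \<forall>C\<in>finite_chains P. \<forall>x\<in>convex hull (vertex P ` C).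
      \<forall>y\<in>convex hull (vertex P ` C). sup_dist P x y < \<delta> \<longrightarrow> d (u x) (u y) < \<epsilon>"
    and \<epsilon>: "0 < (\<epsilon>::real)"
  shows "\<exists>\<delta>>0. \<forall>x\<in>realization_set P. \<forall>y\<in>realization_set P. sup_dist P x y < \<delta> \<longrightarrow> d (u x) (u y) < \<epsilon>"
proof -
  interpret Metric_space X d by (rule X)
  obtain \<delta> where \<delta>: "0 < \<delta>" and step: "\<And>C x y. \<lbrakk>C \<in> finite_chains P; x \<in> convex hull (vertex P ` C);
      y \<in> convex hull (vertex P ` C); sup_dist P x y < \<delta>\<rbrakk> \<Longrightarrow> d (u x) (u y) < \<epsilon> / 3"
    using simplexwise[of "\<epsilon> / 3"] \<epsilon> by auto
  \<comment> \<open>The outer steps have length at most \<open>1 / N\<close>, the middle one at most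
    \<open>1 / N + 1 / (2 N) + 1 / N\<close>; the bound \<open>3 / N\<close> covers all
    three.\<close>
  obtain N :: nat where N: "0 < N" "3 / real N < \<delta>"
  proof -
    obtain N :: nat where "3 / \<delta> < real N" using reals_Archimedean2 by blast
    moreover from this have "0 < real N" using \<delta> by (smt (verit) divide_pos_pos)
    ultimately show thesis using that[of N] \<delta> by (simp add: field_simps)
  qed
  show ?thesis
  proof (intro exI[of _ "1 / (2 * real N)"] conjI ballI impI)
    fix x y
    assume x: "x \<in> realization_set P" and y: "y \<in> realization_set P"
      and xy: "sup_dist P x y < 1 / (2 * real N)"
    have close: "\<bar>x s - y s\<bar> \<le> 1 / (2 * real N)" for s
      using sup_dist_ge[OF x y, of s] xy by linarith
    define x' where "x' = disc N 0 x"
    define y' where "y' = disc N (1/2) y"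
    have half: "1 / (2 * real N) \<le> 1 / real N" "1 / real N + 1 / real N + 1 / real N = 3 / real N"
      using N by (simp_all add: field_simps)
    have dx: "\<bar>x s - x' s\<bar> \<le> 1 / real N" for s
      unfolding x'_def using N by (intro disc_dist) auto
    have dy: "\<bar>y' s - y s\<bar> \<le> 1 / real N" for s
      unfolding y'_def abs_minus_commute[of "disc N (1/2) y s"] using N by (intro disc_dist) auto
    obtain C where C: "C \<in> finite_chains P" "x' \<in> convex hull (vertex P ` C)"
        "y' \<in> convex hull (vertex P ` C)"
      unfolding x'_def y'_def using disc_common_chain[OF P x y N(1) close] .
    note x'P = hull_subset_realization_set[OF C(1,2)] and y'P = hull_subset_realization_set[OF C(1,3)]
    have "0 \<le> 1 / real N" by simp
    have 1: "sup_dist P x x' < \<delta>"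
      using sup_dist_le[OF x dx] N(2) half \<open>0 \<le> 1 / real N\<close> by linarith
    have 2: "sup_dist P y' y < \<delta>"
      using sup_dist_le[OF y'P dy] N(2) half \<open>0 \<le> 1 / real N\<close> by linarith
    have "\<bar>x' s - y' s\<bar> \<le> 3 / real N" for s
      using dx[of s] dy[of s] close[of s] half by linarith
    then have "sup_dist P x' y' \<le> 3 / real N" by (intro sup_dist_le[OF x'P])
    then have 3: "sup_dist P x' y' < \<delta>" using N(2) by linarith
    have "d (u x) (u x') < \<epsilon> / 3"
      using 1 N(1) by (intro step[OF realization_set_supp[OF P x] realization_set_hull_supp[OF P x]])
        (auto simp: x'_def intro!: disc_in_hull_supp[OF P x])
    moreover have "d (u x') (u y') < \<epsilon> / 3" by (rule step[OF C 3])
    moreover have "d (u y') (u y) < \<epsilon> / 3"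
      using 2 N(1) by (intro step[OF realization_set_supp[OF P y] _ realization_set_hull_supp[OF P y]])
        (auto simp: y'_def intro!: disc_in_hull_supp[OF P y])
    moreover have "d (u x) (u y) \<le> d (u x) (u x') + d (u x') (u y)"
      "d (u x') (u y) \<le> d (u x') (u y') + d (u y') (u y)"
      using u x y x'P y'P by (intro triangle; auto)+
    ultimately show "d (u x) (u y) < \<epsilon>" by linarith
  qed (use N in simp)
qed

section \<open>Pushouts\<close>

lemma poset_pushout_universal:
  assumes "poset_pushout \<Z> A B C D f g i j" "Z \<in> \<Z>" "b \<in> monotone_maps B Z" "c \<in> monotone_maps C Z"
    and "compose (Field A) b f = compose (Field A) c g"
  shows "\<exists>!h. h \<in> monotone_maps D Z \<and> compose (Field B) h i = b \<and> compose (Field C) h j = c"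
  using assms by (simp add: poset_pushout_def)

text \<open>The upsets \<open>U\<close> and \<open>V\<close> are maps to the two-element chain that
  agree on \<open>A\<close>. The induced map \<open>h\<close> out of \<open>D\<close> yields
  \<open>W\<close> as the preimage of the top element \<open>v\<close>.\<close>

lemma poset_pushout_upset:
  assumes po: "poset_pushout \<Z> A B C D f g i j" and Z: "two_chain u v \<in> \<Z>" "u \<noteq> v"
    and B: "\<And>x y. (x, y) \<in> B \<Longrightarrow> U x \<Longrightarrow> U y" and C: "\<And>x y. (x, y) \<in> C \<Longrightarrow> V x \<Longrightarrow> V y"
    and compat: "\<And>a. a \<in> Field A \<Longrightarrow> U (f a) \<longleftrightarrow> V (g a)"
  obtains W where "\<And>x. x \<in> Field B \<Longrightarrow> W (i x) \<longleftrightarrow> U x" "\<And>x. x \<in> Field C \<Longrightarrow> W (j x) \<longleftrightarrow> V x"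
proof -
  let ?Z = "two_chain u v"
  let ?b = "\<lambda>x\<in>Field B. if U x then v else u" and ?c = "\<lambda>x\<in>Field C. if V x then v else u"
  have maps: "f \<in> monotone_maps A B" "g \<in> monotone_maps A C"
    using po by (simp_all add: poset_pushout_def)
  have "?b \<in> monotone_maps B ?Z"
    using B by (intro monotone_mapsI) (auto simp: two_chain_def Field_def)
  moreover have "?c \<in> monotone_maps C ?Z"
    using C by (intro monotone_mapsI) (auto simp: two_chain_def Field_def)
  moreover have "compose (Field A) ?b f = compose (Field A) ?c g"
    using compat maps by (auto simp: compose_def monotone_maps_Field)
  ultimately have "\<exists>!h. h \<in> monotone_maps D ?Z \<and> compose (Field B) h i = ?b \<and> compose (Field C) h j = ?c"
    by (rule poset_pushout_universal[OF po Z(1)])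
  then obtain h where h: "compose (Field B) h i = ?b" "compose (Field C) h j = ?c" by blast
  show thesis
  proof
    show "h (i x) = v \<longleftrightarrow> U x" if "x \<in> Field B" for x
      using fun_cong[OF h(1), of x] that Z by (simp add: compose_eq split: if_splits)
    show "h (j x) = v \<longleftrightarrow> V x" if "x \<in> Field C" for x
      using fun_cong[OF h(2), of x] that Z by (simp add: compose_eq split: if_splits)
  qed
qed

text \<open>If \<open>d\<close> were missed, then the upsets \<open>{x. d \<le> x}\<close> and \<open>{x. d < x}\<close> would define two maps to the
  two-element chain that agree on the images.\<close>

lemma poset_pushout_surj:
  assumes po: "poset_pushout \<Z> A B C D f g i j" and Z: "two_chain u v \<in> \<Z>" "u \<noteq> v"
    and D: "D \<in> posets" and d: "d \<in> Field D"
  shows "d \<in> i ` Field B \<union> j ` Field C"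
proof (rule ccontr)
  assume missed: "d \<notin> i ` Field B \<union> j ` Field C"
  let ?Z = "two_chain u v"
  let ?h = "\<lambda>x\<in>Field D. if (d, x) \<in> D then v else u"
  let ?k = "\<lambda>x\<in>Field D. if (d, x) \<in> D \<and> x \<noteq> d then v else u"
  have maps: "f \<in> monotone_maps A B" "g \<in> monotone_maps A C" "i \<in> monotone_maps B D"
      "j \<in> monotone_maps C D" and comm: "compose (Field A) i f = compose (Field A) j g"
    using po by (simp_all add: poset_pushout_def)
  have h: "?h \<in> monotone_maps D ?Z"
  proof (rule monotone_mapsI)
    show "(?h x, ?h y) \<in> ?Z" if "(x, y) \<in> D" for x y
      using that poset_trans[OF D _ that, of d] FieldI1[OF that] FieldI2[OF that]
      by (simp add: two_chain_def)
  qed auto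
  \<comment> \<open>The strict upset stays closed because \<open>d < x <= y\<close> excludes
    \<open>y = d\<close> by antisymmetry.\<close>
  have k: "?k \<in> monotone_maps D ?Z"
  proof (rule monotone_mapsI)
    show "(?k x, ?k y) \<in> ?Z" if "(x, y) \<in> D" for x y
      using that poset_trans[OF D _ that, of d] poset_antisym[OF D, of x d] FieldI1[OF that] FieldI2[OF that]
      by (auto simp add: two_chain_def)
  qed auto
  have "i (f a) = j (g a)" if "a \<in> Field A" for a
    using fun_cong[OF comm, of a] that by (simp add: compose_eq)
  then have "compose (Field A) (compose (Field B) ?h i) f = compose (Field A) (compose (Field C) ?h j) g"
    using maps by (auto simp: compose_def monotone_maps_Field)
  then have "\<exists>!w. w \<in> monotone_maps D ?Z \<and> compose (Field B) w i = compose (Field B) ?h i \<and>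
      compose (Field C) w j = compose (Field C) ?h j"
    by (rule poset_pushout_universal[OF po Z(1) compose_monotone_maps[OF maps(3) h]
          compose_monotone_maps[OF maps(4) h]])
  moreover have "compose (Field B) ?k i = compose (Field B) ?h i"
    "compose (Field C) ?k j = compose (Field C) ?h j"
    using missed by (auto simp: compose_def fun_eq_iff)
  ultimately have "?h = ?k" using h k by blast
  from fun_cong[OF this, of d] show False using d poset_refl[OF D d] Z by simp
qed

lemma Field_barycentric [simp]: "Field (barycentric P) = finite_chains P"
  by (auto simp: barycentric_def relation_of_def Field_def)

lemma barycentric_poset: "barycentric P \<in> posets"
  by (auto simp: posets_def barycentric_def relation_of_def Field_def partial_order_on_def
      preorder_on_def refl_on_def trans_def antisym_def)

lemma uniform_maps_extensional: "h \<in> uniform_maps U V \<Longrightarrow> h \<in> extensional (fst U)"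
  by (simp add: uniform_maps_def PiE_def)

section \<open>Gluing compatible maps along a subdivided pushout\<close>

text \<open>\<open>b\<close> and \<open>c\<close> form a fixed cocone into a metric space. The
  subdivided pushout enters through \<open>chain_lift\<close>, surjectivity on chains, and
  \<open>chain_upset\<close>, by which compatible upsets of chains are determined by images in
  \<open>D\<close>.\<close>

locale realization_pushout =
  fixes A :: "'a rel" and B :: "'b rel" and C :: "'c rel" and D :: "'d rel" and f g i j
    and X :: "'z set" and d and b and c
  assumes posets: "A \<in> posets" "B \<in> posets" "C \<in> posets" "D \<in> posets"
    and maps: "f \<in> monotone_maps A B" "g \<in> monotone_maps A C"
      "i \<in> monotone_maps B D" "j \<in> monotone_maps C D"
    and comm: "compose (Field A) i f = compose (Field A) j g"
    and chain_lift: "\<And>\<tau>. \<tau> \<in> finite_chains D \<Longrightarrow>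
      (\<exists>\<kappa>\<in>finite_chains B. i ` \<kappa> = \<tau>) \<or> (\<exists>\<kappa>\<in>finite_chains C. j ` \<kappa> = \<tau>)"
    and chain_upset: "\<And>U V. \<lbrakk>\<And>\<kappa> \<mu>. \<lbrakk>\<kappa> \<in> finite_chains B; \<mu> \<in> finite_chains B; \<kappa> \<subseteq> \<mu>; U \<kappa>\<rbrakk> \<Longrightarrow> U \<mu>;
      \<And>\<kappa> \<mu>. \<lbrakk>\<kappa> \<in> finite_chains C; \<mu> \<in> finite_chains C; \<kappa> \<subseteq> \<mu>; V \<kappa>\<rbrakk> \<Longrightarrow> V \<mu>;
      \<And>\<alpha>. \<alpha> \<in> finite_chains A \<Longrightarrow> U (f ` \<alpha>) \<longleftrightarrow> V (g ` \<alpha>)\<rbrakk> \<Longrightarrow>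
      \<exists>W. (\<forall>\<kappa>\<in>finite_chains B. W (i ` \<kappa>) \<longleftrightarrow> U \<kappa>) \<and> (\<forall>\<kappa>\<in>finite_chains C. W (j ` \<kappa>) \<longleftrightarrow> V \<kappa>)"
    and X: "Metric_space X d"
    and b: "b \<in> uniform_maps (realization B) (metric_uspace X d)"
    and c: "c \<in> uniform_maps (realization C) (metric_uspace X d)"
    and bc: "compose (realization_set A) b (realization_map A B f) =
      compose (realization_set A) c (realization_map A C g)"
begin

abbreviation "f' \<equiv> realization_map A B f"
abbreviation "g' \<equiv> realization_map A C g"
abbreviation "i' \<equiv> realization_map B D i"
abbreviation "j' \<equiv> realization_map C D j"

lemmas map_f = posets(1,2) maps(1)
lemmas map_g = posets(1,3) maps(2)
lemmas map_i = posets(2,4) maps(3)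
lemmas map_j = posets(3,4) maps(4)

lemma comm': "compose (realization_set A) i' f' = compose (realization_set A) j' g'"
  using realization_map_compose[OF posets(1,2,4) maps(1,3)]
    realization_map_compose[OF posets(1,3,4) maps(2,4)] comm by simp

lemma comm_apply: "x \<in> realization_set A \<Longrightarrow> i' (f' x) = j' (g' x)"
  using fun_cong[OF comm', of x] by (simp add: compose_eq)

lemma bc_apply: "x \<in> realization_set A \<Longrightarrow> b (f' x) = c (g' x)"
  using fun_cong[OF bc, of x] by (simp add: compose_eq)

lemma b_in: "x \<in> realization_set B \<Longrightarrow> b x \<in> X"
  and c_in: "y \<in> realization_set C \<Longrightarrow> c y \<in> X"
  using b c by (auto simp: realization_def uniform_maps_metric)

text \<open>Keep one preimage of each element of \<open>\<tau>\<close>; a nonempty subset of a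
  finite chain is again a finite chain.\<close>

lemma injective_chain_lift:
  assumes "\<tau> \<in> finite_chains D"
  shows "(\<exists>\<kappa>\<in>finite_chains B. inj_on i \<kappa> \<and> i ` \<kappa> = \<tau>) \<or> (\<exists>\<kappa>\<in>finite_chains C. inj_on j \<kappa> \<and> j ` \<kappa> = \<tau>)"
proof -
  have *: "\<exists>\<mu>\<in>finite_chains P. inj_on h \<mu> \<and> h ` \<mu> = \<tau>"
    if \<kappa>: "\<kappa> \<in> finite_chains P" "h ` \<kappa> = \<tau>" for \<kappa> h and P :: "'x rel"
  proof -
    obtain \<mu> where \<mu>: "\<mu> \<subseteq> \<kappa>" "inj_on h \<mu>" "\<tau> = h ` \<mu>"
      using \<kappa>(2) subset_image_inj[of \<tau> h \<kappa>] by blast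
    moreover have "\<tau> \<noteq> {}" using assms by (simp add: finite_chains_def)
    ultimately show ?thesis using finite_chains_subset[OF \<kappa>(1) \<mu>(1)] by blast
  qed
  show ?thesis using chain_lift[OF assms] * by metis
qed

definition glued :: "('d \<Rightarrow> real) \<Rightarrow> 'z \<Rightarrow> bool"
  where "glued z t \<longleftrightarrow>
    (\<exists>x\<in>realization_set B. i' x = z \<and> b x = t) \<or> (\<exists>y\<in>realization_set C. j' y = z \<and> c y = t)"

text \<open>The chains whose simplex contains a lift of \<open>z\<close> with value \<open>t\<close> form an upset that is compatible
  with \<open>f\<close> and \<open>g\<close>, so membership in it depends only on the image in \<open>D\<close>.\<close>

lemma glued_lift:
  assumes "glued z t"
  shows "\<kappa> \<in> finite_chains B \<Longrightarrow> i ` \<kappa> = supp D z \<Longrightarrow>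
      \<exists>x\<in>convex hull (vertex B ` \<kappa>). i' x = z \<and> b x = t" (is "_ \<Longrightarrow> _ \<Longrightarrow> ?U \<kappa>")
    and "\<mu> \<in> finite_chains C \<Longrightarrow> j ` \<mu> = supp D z \<Longrightarrow>
      \<exists>y\<in>convex hull (vertex C ` \<mu>). j' y = z \<and> c y = t" (is "_ \<Longrightarrow> _ \<Longrightarrow> ?V \<mu>")
proof -
  have up: "convex hull (vertex P ` \<kappa>) \<subseteq> convex hull (vertex P ` \<mu>)" if "\<kappa> \<subseteq> \<mu>" for \<kappa> \<mu> and P :: "'x rel"
    using that by (intro Hull.hull_mono image_mono)
  \<comment> \<open>Both simplices are images of the simplex of \<open>\<alpha>\<close>, and over
    each of its points the two lifts have the same image in |D| and the same prescribed
    value.\<close>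
  have compat: "?U (f ` \<alpha>) \<longleftrightarrow> ?V (g ` \<alpha>)" if \<alpha>: "\<alpha> \<in> finite_chains A" for \<alpha>
  proof -
    have in_A: "w \<in> realization_set A" if "w \<in> convex hull (vertex A ` \<alpha>)" for w
      using hull_subset_realization_set[OF \<alpha> that] .
    have "?U (f ` \<alpha>) \<longleftrightarrow> (\<exists>w\<in>convex hull (vertex A ` \<alpha>). i' (f' w) = z \<and> b (f' w) = t)"
      unfolding realization_map_image_hull[OF map_f \<alpha>, symmetric] by blast
    also have "\<dots> \<longleftrightarrow> (\<exists>w\<in>convex hull (vertex A ` \<alpha>). j' (g' w) = z \<and> c (g' w) = t)"
      using comm_apply bc_apply in_A by (metis (no_types, lifting))
    also have "\<dots> \<longleftrightarrow> ?V (g ` \<alpha>)"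
      unfolding realization_map_image_hull[OF map_g \<alpha>, symmetric] by blast
    finally show ?thesis .
  qed
  have "\<exists>W. (\<forall>\<kappa>\<in>finite_chains B. W (i ` \<kappa>) \<longleftrightarrow> ?U \<kappa>) \<and> (\<forall>\<kappa>\<in>finite_chains C. W (j ` \<kappa>) \<longleftrightarrow> ?V \<kappa>)"
  proof (rule chain_upset)
    show "?U \<mu>" if "\<kappa> \<subseteq> \<mu>" "?U \<kappa>" for \<kappa> \<mu>
      using up[OF that(1), of B] that(2) by blast
    show "?V \<mu>" if "\<kappa> \<subseteq> \<mu>" "?V \<kappa>" for \<kappa> \<mu>
      using up[OF that(1), of C] that(2) by blast
  qed (rule compat)
  then obtain W where W: "\<forall>\<kappa>\<in>finite_chains B. W (i ` \<kappa>) \<longleftrightarrow> ?U \<kappa>"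
      "\<forall>\<kappa>\<in>finite_chains C. W (j ` \<kappa>) \<longleftrightarrow> ?V \<kappa>" by (elim exE conjE)
  \<comment> \<open>The lift provided by \<open>glued\<close> lies in the simplex of its own
    support, and that support maps onto the support of \<open>z\<close>.\<close>
  have W_supp: "W (supp D z)"
    using assms unfolding glued_def
  proof (elim disjE bexE conjE)
    fix x assume x: "x \<in> realization_set B" "i' x = z" "b x = t"
    have "?U (supp B x)"
      using x realization_set_hull_supp[OF posets(2) x(1)] by (intro bexI[of _ x]) simp_all
    then show ?thesis
      using bspec[OF W(1) realization_set_supp[OF posets(2) x(1)]] realization_map_supp[OF map_i x(1)] x(2)
      by simp
  next
    fix y assume y: "y \<in> realization_set C" "j' y = z" "c y = t"
    have "?V (supp C y)"
      using y realization_set_hull_supp[OF posets(3) y(1)] by (intro bexI[of _ y]) simp_all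
    then show ?thesis
      using bspec[OF W(2) realization_set_supp[OF posets(3) y(1)]] realization_map_supp[OF map_j y(1)] y(2)
      by simp
  qed
  show "?U \<kappa>" if "\<kappa> \<in> finite_chains B" "i ` \<kappa> = supp D z"
    using bspec[OF W(1) that(1)] W_supp that(2) by simp
  show "?V \<mu>" if "\<mu> \<in> finite_chains C" "j ` \<mu> = supp D z"
    using bspec[OF W(2) that(1)] W_supp that(2) by simp
qed

lemma glued_unique:
  assumes z: "z \<in> realization_set D" and t: "glued z t" and t': "glued z t'"
  shows "t = t'"
  using injective_chain_lift[OF realization_set_supp[OF posets(4) z]]
proof (elim disjE bexE conjE)
  fix \<kappa> assume \<kappa>: "\<kappa> \<in> finite_chains B" "inj_on i \<kappa>" "i ` \<kappa> = supp D z"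
  show ?thesis
    using glued_lift(1)[OF t \<kappa>(1,3)] glued_lift(1)[OF t' \<kappa>(1,3)]
      inj_onD[OF inj_on_chain_realization_map_inj[OF map_i \<kappa>(1,2)]] by metis
next
  fix \<kappa> assume \<kappa>: "\<kappa> \<in> finite_chains C" "inj_on j \<kappa>" "j ` \<kappa> = supp D z"
  show ?thesis
    using glued_lift(2)[OF t \<kappa>(1,3)] glued_lift(2)[OF t' \<kappa>(1,3)]
      inj_onD[OF inj_on_chain_realization_map_inj[OF map_j \<kappa>(1,2)]] by metis
qed

lemma hull_lift:
  assumes "\<tau> \<in> finite_chains D"
  obtains (B) \<kappa> where "\<kappa> \<in> finite_chains B" "inj_on i \<kappa>"
      "convex hull (vertex D ` \<tau>) = i' ` (convex hull (vertex B ` \<kappa>))"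
  | (C) \<kappa> where "\<kappa> \<in> finite_chains C" "inj_on j \<kappa>"
      "convex hull (vertex D ` \<tau>) = j' ` (convex hull (vertex C ` \<kappa>))"
  using injective_chain_lift[OF assms]
proof (elim disjE bexE conjE)
  fix \<kappa> assume "\<kappa> \<in> finite_chains B" "inj_on i \<kappa>" "i ` \<kappa> = \<tau>"
  then show thesis using B realization_map_image_hull[OF map_i] by blast
next
  fix \<kappa> assume "\<kappa> \<in> finite_chains C" "inj_on j \<kappa>" "j ` \<kappa> = \<tau>"
  then show thesis using C realization_map_image_hull[OF map_j] by blast
qed

lemma realization_set_lift:
  assumes "z \<in> realization_set D"
  shows "z \<in> i' ` realization_set B \<union> j' ` realization_set C"
  using assms
proof (rule realization_setE)
  fix \<tau> assume \<tau>: "\<tau> \<in> finite_chains D" and z: "z \<in> convex hull (vertex D ` \<tau>)"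
  show ?thesis
    by (rule hull_lift[OF \<tau>]) (use z hull_subset_realization_set in blast)+
qed

definition glue :: "('d \<Rightarrow> real) \<Rightarrow> 'z"
  where "glue = (\<lambda>z\<in>realization_set D. THE t. glued z t)"

lemma glue_eq: "z \<in> realization_set D \<Longrightarrow> glued z t \<Longrightarrow> glue z = t"
  unfolding glue_def using glued_unique by (auto intro!: the_equality)

lemma glue_i: "x \<in> realization_set B \<Longrightarrow> glue (i' x) = b x"
  by (rule glue_eq) (auto simp: glued_def realization_map_in[OF map_i])

lemma glue_j: "y \<in> realization_set C \<Longrightarrow> glue (j' y) = c y"
  by (rule glue_eq) (auto simp: glued_def realization_map_in[OF map_j])

lemma glue_in: "glue \<in> realization_set D \<rightarrow> X"
  using realization_set_lift glue_i glue_j b_in c_in by fastforce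

text \<open>A simplex of |D| is the isometric image of a simplex of |B| or |C|, so it inherits the
  modulus of \<open>b\<close> or \<open>c\<close>. The smaller of the two radii does not depend on
  the chain.\<close>

lemma glue_simplexwise_uniform:
  assumes "0 < \<epsilon>"
  shows "\<exists>\<delta>>0. \<forall>\<tau>\<in>finite_chains D. \<forall>z\<in>convex hull (vertex D ` \<tau>). \<forall>z'\<in>convex hull (vertex D ` \<tau>).
    sup_dist D z z' < \<delta> \<longrightarrow> d (glue z) (glue z') < \<epsilon>"
proof -
  obtain \<delta>1 where \<delta>1: "0 < \<delta>1" "\<And>x y. \<lbrakk>x \<in> realization_set B; y \<in> realization_set B;
      sup_dist B x y < \<delta>1\<rbrakk> \<Longrightarrow> d (b x) (b y) < \<epsilon>"
    using b assms unfolding realization_def uniform_maps_metric by blast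
  obtain \<delta>2 where \<delta>2: "0 < \<delta>2" "\<And>x y. \<lbrakk>x \<in> realization_set C; y \<in> realization_set C;
      sup_dist C x y < \<delta>2\<rbrakk> \<Longrightarrow> d (c x) (c y) < \<epsilon>"
    using c assms unfolding realization_def uniform_maps_metric by blast
  show ?thesis
  proof (intro exI[of _ "min \<delta>1 \<delta>2"] conjI ballI impI)
    fix \<tau> z z'
    assume \<tau>: "\<tau> \<in> finite_chains D" and z: "z \<in> convex hull (vertex D ` \<tau>)" "z' \<in> convex hull (vertex D ` \<tau>)"
      and dist: "sup_dist D z z' < min \<delta>1 \<delta>2"
    from \<tau> show "d (glue z) (glue z') < \<epsilon>"
    proof (rule hull_lift)
      fix \<kappa> assume \<kappa>: "\<kappa> \<in> finite_chains B" "inj_on i \<kappa>"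
        "convex hull (vertex D ` \<tau>) = i' ` (convex hull (vertex B ` \<kappa>))"
      then obtain x x' where x: "x \<in> convex hull (vertex B ` \<kappa>)" "x' \<in> convex hull (vertex B ` \<kappa>)"
          "z = i' x" "z' = i' x'" using z by auto
      then have "sup_dist B x x' < \<delta>1"
        using inj_on_chain_dist_le[OF map_i \<kappa>(1,2) x(1,2)] dist by simp
      then show ?thesis
        using \<delta>1(2) hull_subset_realization_set[OF \<kappa>(1)] x by (simp add: glue_i)
    next
      fix \<kappa> assume \<kappa>: "\<kappa> \<in> finite_chains C" "inj_on j \<kappa>"
        "convex hull (vertex D ` \<tau>) = j' ` (convex hull (vertex C ` \<kappa>))"
      then obtain x x' where x: "x \<in> convex hull (vertex C ` \<kappa>)" "x' \<in> convex hull (vertex C ` \<kappa>)"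
          "z = j' x" "z' = j' x'" using z by auto
      then have "sup_dist C x x' < \<delta>2"
        using inj_on_chain_dist_le[OF map_j \<kappa>(1,2) x(1,2)] dist by simp
      then show ?thesis
        using \<delta>2(2) hull_subset_realization_set[OF \<kappa>(1)] x by (simp add: glue_j)
    qed
  qed (use \<delta>1 \<delta>2 in simp)
qed

lemma glue_uniform: "glue \<in> uniform_maps (realization D) (metric_uspace X d)"
  unfolding realization_def uniform_maps_metric
proof (intro conjI allI impI)
  have "glue \<in> extensional (realization_set D)" by (simp add: glue_def)
  with glue_in show "glue \<in> realization_set D \<rightarrow>\<^sub>E X" by (simp add: PiE_def)
qed (rule simplexwise_uniform_imp_uniform[OF posets(4) X glue_in glue_simplexwise_uniform])

text \<open>The images of |B| and |C| cover |D|, so the cocone forces every value.\<close>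

lemma ex1_glue:
  "\<exists>!u. u \<in> uniform_maps (realization D) (metric_uspace X d) \<and>
    compose (realization_set B) u i' = b \<and> compose (realization_set C) u j' = c"
proof (rule ex1I[of _ glue], intro conjI glue_uniform)
  have ext: "b \<in> extensional (realization_set B)" "c \<in> extensional (realization_set C)"
    using uniform_maps_extensional[OF b] uniform_maps_extensional[OF c] by simp_all
  show "compose (realization_set B) glue i' = b"
    using ext by (intro extensionalityI[of _ "realization_set B"]) (auto simp: compose_eq glue_i compose_extensional)
  show "compose (realization_set C) glue j' = c"
    using ext by (intro extensionalityI[of _ "realization_set C"]) (auto simp: compose_eq glue_j compose_extensional)
  fix u
  assume u: "u \<in> uniform_maps (realization D) (metric_uspace X d) \<and>
    compose (realization_set B) u i' = b \<and> compose (realization_set C) u j' = c"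
  show "u = glue"
  proof (rule extensionalityI[of _ "realization_set D"])
    fix z assume "z \<in> realization_set D"
    from realization_set_lift[OF this] show "u z = glue z"
    proof (elim UnE imageE)
      fix x assume "z = i' x" "x \<in> realization_set B"
      moreover have "compose (realization_set B) u i' x = b x" using u by simp
      ultimately show ?thesis by (simp add: compose_eq glue_i)
    next
      fix y assume "z = j' y" "y \<in> realization_set C"
      moreover have "compose (realization_set C) u j' y = c y" using u by simp
      ultimately show ?thesis by (simp add: compose_eq glue_j)
    qed
  qed (use uniform_maps_extensional[OF conjunct1[OF u]] in \<open>simp_all add: glue_def\<close>)
qed

end

text \<open>The square of posets provides the maps and commutativity. Lifting of chains and gluing
  of upsets are \<open>poset_pushout_surj\<close> and \<open>poset_pushout_upset\<close> applied to
  the subdivided square.\<close>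

lemma realization_preserves_pushout:
  assumes posets: "A \<in> posets" "B \<in> posets" "C \<in> posets" "D \<in> posets"
    and po: "poset_pushout \<Y> A B C D f g i j"
    and po': "poset_pushout \<Z> (barycentric A) (barycentric B) (barycentric C) (barycentric D)
      (barycentric_map A f) (barycentric_map A g) (barycentric_map B i) (barycentric_map C j)"
    and Z: "two_chain u v \<in> \<Z>" "u \<noteq> v"
  shows "uspace_pushout metrizable_uspaces (realization A) (realization B) (realization C)
    (realization D) (realization_map A B f) (realization_map A C g)
    (realization_map B D i) (realization_map C D j)"
  unfolding uspace_pushout_def
proof (intro conjI ballI impI)
  have maps: "f \<in> monotone_maps A B" "g \<in> monotone_maps A C" "i \<in> monotone_maps B D"
      "j \<in> monotone_maps C D" and comm: "compose (Field A) i f = compose (Field A) j g"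
    using po by (simp_all add: poset_pushout_def)
  show "realization_map A B f \<in> uniform_maps (realization A) (realization B)"
    by (rule realization_map_uniform[OF posets(1,2) maps(1)])
  show "realization_map A C g \<in> uniform_maps (realization A) (realization C)"
    by (rule realization_map_uniform[OF posets(1,3) maps(2)])
  show "realization_map B D i \<in> uniform_maps (realization B) (realization D)"
    by (rule realization_map_uniform[OF posets(2,4) maps(3)])
  show "realization_map C D j \<in> uniform_maps (realization C) (realization D)"
    by (rule realization_map_uniform[OF posets(3,4) maps(4)])
  show "compose (fst (realization A)) (realization_map B D i) (realization_map A B f) =
      compose (fst (realization A)) (realization_map C D j) (realization_map A C g)"
    using realization_map_compose[OF posets(1,2,4) maps(1,3)]
      realization_map_compose[OF posets(1,3,4) maps(2,4)] comm by simp
  have lift: "(\<exists>\<kappa>\<in>finite_chains B. i ` \<kappa> = \<tau>) \<or> (\<exists>\<kappa>\<in>finite_chains C. j ` \<kappa> = \<tau>)"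
    if "\<tau> \<in> finite_chains D" for \<tau>
    using poset_pushout_surj[OF po' Z barycentric_poset, of \<tau>] that
    by (auto simp: barycentric_map_def)
  have upset: "\<exists>W. (\<forall>\<kappa>\<in>finite_chains B. W (i ` \<kappa>) \<longleftrightarrow> U \<kappa>) \<and> (\<forall>\<kappa>\<in>finite_chains C. W (j ` \<kappa>) \<longleftrightarrow> V \<kappa>)"
    if U: "\<And>\<kappa> \<mu>. \<lbrakk>\<kappa> \<in> finite_chains B; \<mu> \<in> finite_chains B; \<kappa> \<subseteq> \<mu>; U \<kappa>\<rbrakk> \<Longrightarrow> U \<mu>"
      and V: "\<And>\<kappa> \<mu>. \<lbrakk>\<kappa> \<in> finite_chains C; \<mu> \<in> finite_chains C; \<kappa> \<subseteq> \<mu>; V \<kappa>\<rbrakk> \<Longrightarrow> V \<mu>"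
      and UV: "\<And>\<alpha>. \<alpha> \<in> finite_chains A \<Longrightarrow> U (f ` \<alpha>) \<longleftrightarrow> V (g ` \<alpha>)" for U V
  proof -
    obtain W where "\<And>\<kappa>. \<kappa> \<in> finite_chains B \<Longrightarrow> W (barycentric_map B i \<kappa>) \<longleftrightarrow> U \<kappa>"
        "\<And>\<kappa>. \<kappa> \<in> finite_chains C \<Longrightarrow> W (barycentric_map C j \<kappa>) \<longleftrightarrow> V \<kappa>"
    proof (rule poset_pushout_upset[OF po' Z, of U V])
      show "U y" if "(x, y) \<in> barycentric B" "U x" for x y
        using that U[of x y] by (simp add: barycentric_def relation_of_def)
      show "V y" if "(x, y) \<in> barycentric C" "V x" for x y
        using that V[of x y] by (simp add: barycentric_def relation_of_def)
      show "U (barycentric_map A f a) \<longleftrightarrow> V (barycentric_map A g a)" if "a \<in> Field (barycentric A)" for a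
        using that UV[of a] by (simp add: barycentric_map_def)
    qed auto
    then show ?thesis by (intro exI[of _ W]) (auto simp: barycentric_map_def)
  qed
  fix Z :: "'z uspace" and b c
  assume "Z \<in> metrizable_uspaces"
    and b: "b \<in> uniform_maps (realization B) Z" and c: "c \<in> uniform_maps (realization C) Z"
    and bc: "compose (fst (realization A)) b (realization_map A B f) =
      compose (fst (realization A)) c (realization_map A C g)"
  then obtain X d where X: "Metric_space X d" and Z: "Z = metric_uspace X d"
    by (auto simp: metrizable_uspaces_def)
  interpret realization_pushout A B C D f g i j X d b c
    by (rule realization_pushout.intro[OF posets maps comm lift upset X])
      (use b c bc in \<open>simp_all add: Z\<close>)
  show "\<exists>!u. u \<in> uniform_maps (realization D) Z \<and>
      compose (fst (realization B)) u (realization_map B D i) = b \<and>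
      compose (fst (realization C)) u (realization_map C D j) = c"
    using ex1_glue by (simp add: Z)
qed

theorem theorem3p8:
  assumes "infinite (UNIV :: 'u set)"
  shows
    \<comment> \<open>realization is a functor\<close>
    "(\<forall>P \<in> (countable_posets :: 'a rel set).
        realization P \<in> metrizable_uspaces \<and>
        realization_map P P (\<lambda>x\<in>Field P. x) = (\<lambda>x\<in>fst (realization P). x)) \<and>
     (\<forall>P \<in> (countable_posets :: 'a rel set). \<forall>Q \<in> (countable_posets :: 'b rel set).
        \<forall>f \<in> monotone_maps P Q.
        realization_map P Q f \<in> uniform_maps (realization P) (realization Q)) \<and>
     (\<forall>P \<in> (countable_posets :: 'a rel set). \<forall>Q \<in> (countable_posets :: 'b rel set).
      \<forall>R \<in> (countable_posets :: 'c rel set).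
        \<forall>f \<in> monotone_maps P Q. \<forall>g \<in> monotone_maps Q R.
        realization_map P R (compose (Field P) g f) =
          compose (fst (realization P)) (realization_map Q R g) (realization_map P Q f)) \<and>
     \<comment> \<open>it preserves pullbacks\<close>
     (\<forall>P \<in> (countable_posets :: 'a rel set). \<forall>A \<in> (countable_posets :: 'b rel set).
      \<forall>B \<in> (countable_posets :: 'c rel set). \<forall>C \<in> (countable_posets :: 'd rel set).
      \<forall>p q f g.
        poset_pullback (countable_posets :: 'u rel set) P A B C p q f g \<longrightarrow>
        uspace_pullback (metrizable_uspaces :: 'z uspace set)
          (realization P) (realization A) (realization B) (realization C)
          (realization_map P A p) (realization_map P B q)
          (realization_map A C f) (realization_map B C g)) \<and>
     \<comment> \<open>it preserves the pushouts that remain pushouts upon barycentric subdivision\<close>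
     (\<forall>A \<in> (countable_posets :: 'a rel set). \<forall>B \<in> (countable_posets :: 'b rel set).
      \<forall>C \<in> (countable_posets :: 'c rel set). \<forall>D \<in> (countable_posets :: 'd rel set).
      \<forall>f g i j.
        poset_pushout (countable_posets :: 'u rel set) A B C D f g i j \<and>
        poset_pushout (posets :: 'u rel set)
          (barycentric A) (barycentric B) (barycentric C) (barycentric D)
          (barycentric_map A f) (barycentric_map A g)
          (barycentric_map B i) (barycentric_map C j) \<longrightarrow>
        uspace_pushout (metrizable_uspaces :: 'z uspace set)
          (realization A) (realization B) (realization C) (realization D)
          (realization_map A B f) (realization_map A C g)
          (realization_map B D i) (realization_map C D j))"
proof (intro conjI ballI allI impI)
  \<comment> \<open>Two distinct elements of the infinite test type carry the two-element chain,
    which belongs to both test classes.\<close>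
  obtain u v :: 'u where "u \<noteq> v"
    using assms ex_new_if_finite[of "{undefined :: 'u}"] by auto
  then have two: "two_chain u v \<in> countable_posets" "two_chain u v \<in> posets" "u \<noteq> v"
    using two_chain_countable_poset[of u v] by (simp_all add: countable_posets_def)
  note cp = countable_posets_def
  show "realization P \<in> metrizable_uspaces" for P :: "'a rel"
    by (rule realization_metrizable)
  show "realization_map P P (\<lambda>x\<in>Field P. x) = (\<lambda>x\<in>fst (realization P). x)"
    if "P \<in> countable_posets" for P :: "'a rel"
    using that by (simp add: cp realization_map_identity)
  show "realization_map P Q f \<in> uniform_maps (realization P) (realization Q)"
    if "P \<in> countable_posets" "Q \<in> countable_posets" "f \<in> monotone_maps P Q"
    for P :: "'a rel" and Q :: "'b rel" and f
    using that by (simp add: cp realization_map_uniform)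
  show "realization_map P R (compose (Field P) g f) =
      compose (fst (realization P)) (realization_map Q R g) (realization_map P Q f)"
    if "P \<in> countable_posets" "Q \<in> countable_posets" "R \<in> countable_posets"
      "f \<in> monotone_maps P Q" "g \<in> monotone_maps Q R"
    for P :: "'a rel" and Q :: "'b rel" and R :: "'c rel" and f g
    using that by (simp add: cp realization_map_compose)
  show "uspace_pullback (metrizable_uspaces :: 'z uspace set)
      (realization P) (realization A) (realization B) (realization C)
      (realization_map P A p) (realization_map P B q) (realization_map A C f) (realization_map B C g)"
    if "P \<in> countable_posets" "A \<in> countable_posets" "B \<in> countable_posets" "C \<in> countable_posets"
      "poset_pullback (countable_posets :: 'u rel set) P A B C p q f g"
    for P :: "'a rel" and A :: "'b rel" and B :: "'c rel" and C :: "'d rel" and p q f g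
    using that by (intro realization_preserves_pullback[OF _ _ _ _ that(5) two(1,3)]) (simp_all add: cp)
  show "uspace_pushout (metrizable_uspaces :: 'z uspace set)
      (realization A) (realization B) (realization C) (realization D)
      (realization_map A B f) (realization_map A C g) (realization_map B D i) (realization_map C D j)"
    if "A \<in> countable_posets" "B \<in> countable_posets" "C \<in> countable_posets" "D \<in> countable_posets"
      and po: "poset_pushout (countable_posets :: 'u rel set) A B C D f g i j \<and>
        poset_pushout (posets :: 'u rel set)
          (barycentric A) (barycentric B) (barycentric C) (barycentric D)
          (barycentric_map A f) (barycentric_map A g) (barycentric_map B i) (barycentric_map C j)"
    for A :: "'a rel" and B :: "'b rel" and C :: "'c rel" and D :: "'d rel" and f g i j
    using that
    by (intro realization_preserves_pushout[OF _ _ _ _ po[THEN conjunct1] po[THEN conjunct2] two(2,3)])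
      (simp_all add: cp)
qed

end
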